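(* Let $V$ be a complex vector space with $\dim V=n+1>2$, let $d\ge 1$, and let $f\in \mathrm{SOS}_2\subset \mathrm{Sym}^{2d}V$ be generic. Then $\mathrm{SOS}_2(f)$ has exactly two irreducible components, each isomorphic to $\mathrm{SO}(2)$.
   Context: $\mathrm{Sym}^mV$ denotes the space of homogeneous polynomials of degree $m$ in $x_0,\dots,x_n$ over $\mathbb{C}$, where $x_0,\dots,x_n$ is a basis of $V$. For $k\ge1$, $\mathrm{SOS}_k\subset \mathrm{Sym}^{2d}V$ is the Zariski closure of $\{f_1^2+\dots+f_k^2 : f_i\in \mathrm{Sym}^dV\}$; it is an irreducible affine variety. For $f\in\mathrm{SOS}_k$, $\mathrm{SOS}_k(f)=\{(f_1,\dots,f_k)\in \prod_{i=1}^k\mathrm{Sym}^dV : \sum_{i=1}^k f_i^2=f\}$, viewed as an affine algebraic variety. "Generic $f\in\mathrm{SOS}_k$" means: for all $f$ in some dense Zariski-open subset of $\mathrm{SOS}_k$. $\mathrm{SO}(2)$ is the complex special orthogonal group $\{O\in \mathbb{C}^{2\times 2}: O^tO=I,\ \det O=1\}$. *)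

theory Defs
  imports "HOL-Analysis.Analysis" "HOL-Library.Poly_Mapping"
begin

section \<open>Affine varieties given by coordinate functions\<close>

text \<open>
  An affine space is represented by a set \<open>W\<close> together with a set \<open>C\<close> of coordinate functions
  on the ambient type. Only finitely many of them need be nonconstant on \<open>W\<close>; the others do no
  harm, since constants are polynomial functions anyway. Varieties are meant classically, as sets
  of complex points.
\<close>

inductive_set polynomial_functions :: "('w \<Rightarrow> complex) set \<Rightarrow> ('w \<Rightarrow> complex) set"
  for C :: "('w \<Rightarrow> complex) set" where
  coord: "c \<in> C \<Longrightarrow> c \<in> polynomial_functions C"
| const: "(\<lambda>w. a) \<in> polynomial_functions C"
| add: "F \<in> polynomial_functions C \<Longrightarrow> G \<in> polynomial_functions C \<Longrightarrow>
    (\<lambda>w. F w + G w) \<in> polynomial_functions C"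
| mult: "F \<in> polynomial_functions C \<Longrightarrow> G \<in> polynomial_functions C \<Longrightarrow>
    (\<lambda>w. F w * G w) \<in> polynomial_functions C"

definition zariski :: "('w \<Rightarrow> complex) set \<Rightarrow> 'w set \<Rightarrow> 'w topology" where
  "zariski C W = topology (\<lambda>U. \<exists>S\<subseteq>polynomial_functions C. U = {w\<in>W. \<exists>F\<in>S. F w \<noteq> 0})"

lemma istopology_zariski:
  "istopology (\<lambda>U. \<exists>S\<subseteq>polynomial_functions C. U = {w\<in>W. \<exists>F\<in>S. F w \<noteq> 0})"
  unfolding istopology_def
proof (intro conjI allI impI)
  fix U V
  assume "\<exists>S\<subseteq>polynomial_functions C. U = {w\<in>W. \<exists>F\<in>S. F w \<noteq> 0}"
    and "\<exists>S\<subseteq>polynomial_functions C. V = {w\<in>W. \<exists>F\<in>S. F w \<noteq> 0}"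
  then obtain S T
    where S: "S \<subseteq> polynomial_functions C" "U = {w\<in>W. \<exists>F\<in>S. F w \<noteq> 0}"
      and T: "T \<subseteq> polynomial_functions C" "V = {w\<in>W. \<exists>F\<in>T. F w \<noteq> 0}"
    by (elim exE conjE)
  define R where "R = (\<lambda>(F, G) w. F w * G w) ` (S \<times> T)"
  have "R \<subseteq> polynomial_functions C"
    unfolding R_def using S(1) T(1) by (auto intro!: polynomial_functions.mult)
  moreover have "U \<inter> V = {w\<in>W. \<exists>H\<in>R. H w \<noteq> 0}"
    unfolding S(2) T(2) R_def by (simp add: set_eq_iff Bex_def) metis
  ultimately show "\<exists>R\<subseteq>polynomial_functions C. U \<inter> V = {w\<in>W. \<exists>F\<in>R. F w \<noteq> 0}"
    by (intro exI[of _ R] conjI)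
next
  fix K
  assume *: "\<forall>U\<in>K. \<exists>S\<subseteq>polynomial_functions C. U = {w\<in>W. \<exists>F\<in>S. F w \<noteq> 0}"
  from bchoice[OF *] obtain S
    where S: "\<forall>U\<in>K. S U \<subseteq> polynomial_functions C \<and> U = {w\<in>W. \<exists>F\<in>S U. F w \<noteq> 0}"
    by (elim exE)
  define R where "R = (\<Union>U\<in>K. S U)"
  have mem: "w \<in> U \<longleftrightarrow> w \<in> W \<and> (\<exists>F\<in>S U. F w \<noteq> 0)" if "U \<in> K" for U w
  proof -
    have "U = {w\<in>W. \<exists>F\<in>S U. F w \<noteq> 0}"
      using bspec[OF S that] by (rule conjunct2)
    from arg_cong[OF this, of "\<lambda>X. w \<in> X"] show ?thesis
      by (simp only: mem_Collect_eq)
  qed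
  have "R \<subseteq> polynomial_functions C"
    unfolding R_def by (rule UN_least) (rule conjunct1[OF bspec[OF S]])
  moreover have "\<Union>K = {w\<in>W. \<exists>F\<in>R. F w \<noteq> 0}"
  proof (rule set_eqI)
    fix w
    have "w \<in> \<Union>K \<longleftrightarrow> (\<exists>U\<in>K. w \<in> W \<and> (\<exists>F\<in>S U. F w \<noteq> 0))"
      unfolding Union_iff by (rule bex_cong[OF refl]) (rule mem)
    also have "\<dots> \<longleftrightarrow> w \<in> {w\<in>W. \<exists>F\<in>R. F w \<noteq> 0}"
      unfolding R_def by auto
    finally show "w \<in> \<Union>K \<longleftrightarrow> w \<in> {w\<in>W. \<exists>F\<in>R. F w \<noteq> 0}" .
  qed
  ultimately show "\<exists>R\<subseteq>polynomial_functions C. \<Union>K = {w\<in>W. \<exists>F\<in>R. F w \<noteq> 0}"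
    by (intro exI[of _ R] conjI)
qed

lemma openin_zariski:
  "openin (zariski C W) U \<longleftrightarrow>
    (\<exists>S\<subseteq>polynomial_functions C. U = {w\<in>W. \<exists>F\<in>S. F w \<noteq> 0})"
  unfolding zariski_def topology_inverse'[OF istopology_zariski] by (rule refl)

lemma topspace_zariski [simp]: "topspace (zariski C W) = W"
proof -
  have "openin (zariski C W) W"
    unfolding openin_zariski
    by (rule exI[of _ "{\<lambda>w. 1}"]) (auto intro: polynomial_functions.const)
  moreover have "\<And>U. openin (zariski C W) U \<Longrightarrow> U \<subseteq> W"
    by (auto simp: openin_zariski)
  ultimately show ?thesis
    unfolding topspace_def by blast
qed

lemma closedin_zariski:
  "closedin (zariski C W) Z \<longleftrightarrow>
    (\<exists>S\<subseteq>polynomial_functions C. Z = {w\<in>W. \<forall>F\<in>S. F w = 0})"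
proof -
  have eq: "(Z \<subseteq> W \<and> W - Z = {w\<in>W. \<exists>F\<in>S. F w \<noteq> 0}) = (Z = {w\<in>W. \<forall>F\<in>S. F w = 0})"
    for S :: "('a \<Rightarrow> complex) set"
    by blast
  show ?thesis
    unfolding closedin_def openin_zariski topspace_zariski eq[symmetric] by blast
qed

definition irreducible_space :: "'a topology \<Rightarrow> bool" where
  "irreducible_space X \<longleftrightarrow> topspace X \<noteq> {} \<and>
    (\<forall>A B. closedin X A \<longrightarrow> closedin X B \<longrightarrow> topspace X = A \<union> B \<longrightarrow>
      A = topspace X \<or> B = topspace X)"

definition irreducible_components :: "'a topology \<Rightarrow> 'a set set" where
  "irreducible_components X =
    {Z. Z \<subseteq> topspace X \<and> irreducible_space (subtopology X Z) \<and>
      (\<forall>Z'. Z \<subseteq> Z' \<longrightarrow> Z' \<subseteq> topspace X \<longrightarrow> irreducible_space (subtopology X Z') \<longrightarrow> Z' = Z)}"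

definition variety_morphism ::
  "('v \<Rightarrow> complex) set \<Rightarrow> 'v set \<Rightarrow> ('w \<Rightarrow> complex) set \<Rightarrow> 'w set \<Rightarrow> ('v \<Rightarrow> 'w) \<Rightarrow> bool" where
  "variety_morphism C X D Y \<phi> \<longleftrightarrow> \<phi> \<in> X \<rightarrow> Y \<and>
    (\<forall>y\<in>D. \<exists>F\<in>polynomial_functions C. \<forall>x\<in>X. y (\<phi> x) = F x)"

definition isomorphic_varieties ::
  "('v \<Rightarrow> complex) set \<Rightarrow> 'v set \<Rightarrow> ('w \<Rightarrow> complex) set \<Rightarrow> 'w set \<Rightarrow> bool" where
  "isomorphic_varieties C X D Y \<longleftrightarrow>
    (\<exists>\<phi> \<psi>. variety_morphism C X D Y \<phi> \<and> variety_morphism D Y C X \<psi> \<and>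
      (\<forall>x\<in>X. \<psi> (\<phi> x) = x) \<and> (\<forall>y\<in>Y. \<phi> (\<psi> y) = y))"

text \<open>The property \<open>P\<close> holds for generic points of \<open>X\<close>.\<close>

definition generically :: "'a topology \<Rightarrow> ('a \<Rightarrow> bool) \<Rightarrow> bool" where
  "generically X P \<longleftrightarrow>
    (\<exists>U. openin X U \<and> X closure_of U = topspace X \<and> (\<forall>x\<in>U. P x))"


section \<open>Homogeneous polynomials and sums of squares\<close>

text \<open>
  A polynomial is a finitely supported map from monomials to coefficients, a monomial being a
  finitely supported map from variable indices to exponents; the product of
  \<^theory>\<open>HOL-Library.Poly_Mapping\<close> is the convolution product.
\<close>

type_synonym cpoly = "(nat \<Rightarrow>\<^sub>0 nat) \<Rightarrow>\<^sub>0 complex"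

text \<open>\<open>Sym n m\<close> is the space of forms of degree \<open>m\<close> in the \<open>n + 1\<close> variables
  \<open>x\<^sub>0, \<dots>, x\<^sub>n\<close>.\<close>

definition Sym :: "nat \<Rightarrow> nat \<Rightarrow> cpoly set" where
  "Sym n m = {p. \<forall>a\<in>Poly_Mapping.keys p.
      Poly_Mapping.keys a \<subseteq> {0..n} \<and> (\<Sum>i=0..n. Poly_Mapping.lookup a i) = m}"

definition coeffs :: "(cpoly \<Rightarrow> complex) set" where
  "coeffs = {\<lambda>p. Poly_Mapping.lookup p a | a. True}"

definition SOS :: "nat \<Rightarrow> nat \<Rightarrow> nat \<Rightarrow> cpoly set" where
  "SOS n d k = zariski coeffs (Sym n (2 * d)) closure_of
    {(\<Sum>j<k. (g j)\<^sup>2) | g. \<forall>j<k. g j \<in> Sym n d}"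

definition SOS_space :: "nat \<Rightarrow> nat \<Rightarrow> nat \<Rightarrow> cpoly topology" where
  "SOS_space n d k = subtopology (zariski coeffs (Sym n (2 * d))) (SOS n d k)"

definition tuple_coeffs :: "nat \<Rightarrow> ((nat \<Rightarrow> cpoly) \<Rightarrow> complex) set" where
  "tuple_coeffs k = {\<lambda>g. Poly_Mapping.lookup (g j) a | j a. j < k}"

definition SOS_fibre :: "nat \<Rightarrow> nat \<Rightarrow> nat \<Rightarrow> cpoly \<Rightarrow> (nat \<Rightarrow> cpoly) set" where
  "SOS_fibre n d k f = {g \<in> (\<Pi>\<^sub>E j\<in>{..<k}. Sym n d). (\<Sum>j<k. (g j)\<^sup>2) = f}"

definition SOS_fibre_space :: "nat \<Rightarrow> nat \<Rightarrow> nat \<Rightarrow> cpoly \<Rightarrow> (nat \<Rightarrow> cpoly) topology" where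
  "SOS_fibre_space n d k f =
    subtopology (zariski (tuple_coeffs k) (\<Pi>\<^sub>E j\<in>{..<k}. Sym n d)) (SOS_fibre n d k f)"


section \<open>The complex special orthogonal group\<close>

definition matrix_entries :: "(complex^2^2 \<Rightarrow> complex) set" where
  "matrix_entries = {\<lambda>A. A $ i $ j | i j. True}"

definition SO2 :: "(complex^2^2) set" where
  "SO2 = {A. transpose A ** A = mat 1 \<and> det A = 1}"

end

(*
  Over the complex numbers g0^2 + g1^2 = (g0 + i g1) (g0 - i g1), so sums of two squares are products
  u v of two forms of degree d. If f = u v and (up to scalars and order) this is the only such
  factorization, then the fibre over f consists of the two disjoint curves {(s u, v / s)} and
  {(s v, u / s)}, s nonzero, and s = a + i b, 1 / s = a - i b identifies each of them with SO(2).

  It remains to find a dense open set of f with a unique factorization. Normalize f to be monic in one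
  variable and apply a Kronecker substitution, which turns f into a univariate monic polynomial without
  losing information. A factorization of f is then a subset of the roots of that polynomial whose partial
  products are again in the image of the substitution. Forgetting the roots is a finite map, whose
  image is closed by elimination with resultants; hence both the products u v and the products with a
  second factorization (or a multiple root) form closed sets of monic forms. Finally one explicit
  product has a unique factorization, and it is joined by polynomial curves to all other products, so
  its open neighbourhood is dense.
*)
theory Submission
  imports Defs "Subresultants.Subresultant_Gcd" "HOL-Computational_Algebra.Field_as_Ring"
    "HOL-Computational_Algebra.Fundamental_Theorem_Algebra"
begin

section \<open>Elimination of roots\<close>

text \<open>A point of \<open>SOS n d 2\<close> is by definition only in the Zariski closure of the
  products, so even the existence of a factorization has to be proved. This is why closedness of the
  products is needed, and not only that of the bad ones. Closedness comes from finiteness: the roots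
  of a monic polynomial cannot escape to infinity. Hence the normalization, which is undone by
  clearing a power of the leading coefficient. After the Kronecker substitution, factors are chosen
  among finitely many subsets of labelled roots, and images of forms are recognized by gaps in their
  exponents, that is, by linear equations. Multiple roots count as bad so that a partial product
  determines its set of labels; this also makes the two factors distinct, which keeps the two curves
  of the fibre apart. Irreducibility of generic forms never enters, only uniqueness among
  factorizations into two factors of degree \<open>d\<close>. At least three variables are
  essential: for \<open>n = 1\<close> and \<open>d \<ge> 2\<close>, forms split into linear factors
  that can be grouped in several ways.\<close>

lemma polynomial_functions_comp:
  assumes "F \<in> polynomial_functions C"
    and "\<And>c. c \<in> C \<Longrightarrow> (\<lambda>x. c (h x)) \<in> polynomial_functions D"
  shows "(\<lambda>x. F (h x)) \<in> polynomial_functions D"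
  using assms(1)
proof induction
  case (coord c)
  then show ?case by (rule assms(2))
qed (auto intro: polynomial_functions.const polynomial_functions.add polynomial_functions.mult)

lemma polynomial_functions_uminus:
  "F \<in> polynomial_functions C \<Longrightarrow> (\<lambda>x. - F x) \<in> polynomial_functions C"
  using polynomial_functions.mult[OF polynomial_functions.const[of "-1"], of F C] by simp

lemma polynomial_functions_diff:
  "F \<in> polynomial_functions C \<Longrightarrow> G \<in> polynomial_functions C \<Longrightarrow>
    (\<lambda>x. F x - G x) \<in> polynomial_functions C"
  using polynomial_functions.add[OF _ polynomial_functions_uminus, of F C G] by simp

lemma polynomial_functions_sum:
  "(\<And>i. i \<in> I \<Longrightarrow> F i \<in> polynomial_functions C) \<Longrightarrow> (\<lambda>x. \<Sum>i\<in>I. F i x) \<in> polynomial_functions C"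
  by (induction I rule: infinite_finite_induct)
    (auto intro: polynomial_functions.const polynomial_functions.add)

lemma polynomial_functions_prod:
  "(\<And>i. i \<in> I \<Longrightarrow> F i \<in> polynomial_functions C) \<Longrightarrow> (\<lambda>x. \<Prod>i\<in>I. F i x) \<in> polynomial_functions C"
  by (induction I rule: infinite_finite_induct)
    (auto intro: polynomial_functions.const polynomial_functions.mult)

lemma polynomial_functions_if:
  "F \<in> polynomial_functions C \<Longrightarrow> G \<in> polynomial_functions C \<Longrightarrow>
    (\<lambda>x. if b then F x else G x) \<in> polynomial_functions C"
  by (cases b) simp_all

lemma closedin_zariskiI:
  assumes "Z \<subseteq> W"
    and "\<And>w. w \<in> W - Z \<Longrightarrow> \<exists>F\<in>polynomial_functions C. (\<forall>x\<in>Z. F x = 0) \<and> F w \<noteq> 0"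
  shows "closedin (zariski C W) Z"
  unfolding closedin_zariski
  by (rule exI[of _ "{F \<in> polynomial_functions C. \<forall>x\<in>Z. F x = 0}"]) (use assms in blast)

lemma closedin_zariski_zeros:
  "F \<in> polynomial_functions C \<Longrightarrow> closedin (zariski C W) {w \<in> W. F w = 0}"
  unfolding closedin_zariski by (rule exI[of _ "{F}"]) auto

text \<open>A finite union of hyperplanes is not the whole space.\<close>

lemma nonvanishing_combination:
  assumes "finite K" and "\<And>x. x \<in> K \<Longrightarrow> \<exists>F\<in>S. F x \<noteq> 0" and "S \<subseteq> polynomial_functions C"
    and "\<And>F x. F \<in> S \<Longrightarrow> x \<in> Z \<Longrightarrow> F x = 0"
  shows "\<exists>G\<in>polynomial_functions C. (\<forall>x\<in>Z. G x = 0) \<and> (\<forall>x\<in>K. G x \<noteq> 0)"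
  using assms(1,2)
proof (induction K rule: finite_induct)
  case empty
  show ?case by (rule bexI[OF _ polynomial_functions.const[of 0]]) auto
next
  case (insert k K)
  then obtain G where G: "G \<in> polynomial_functions C" "\<forall>x\<in>Z. G x = 0" "\<forall>x\<in>K. G x \<noteq> 0"
    by auto
  obtain F where F: "F \<in> S" "F k \<noteq> 0"
    using insert.prems by auto
  \<comment> \<open>Each point with \<open>F x \<noteq> 0\<close> forbids a single value of
    \<open>e\<close>. Where \<open>F x = 0\<close>, division by zero merely forbids
    \<open>e = 0\<close>, and \<open>G x\<close> is already nonzero there because such a point is
    not \<open>k\<close>.\<close>
  have "finite ((\<lambda>x. - G x / F x) ` insert k K)"
    using insert.hyps by simp
  then obtain e :: complex where e: "e \<notin> (\<lambda>x. - G x / F x) ` insert k K"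
    using ex_new_if_finite[OF infinite_UNIV_char_0] by blast
  show ?case
  proof (rule bexI)
    show "(\<lambda>x. G x + e * F x) \<in> polynomial_functions C"
      using G(1) F(1) assms(3)
      by (intro polynomial_functions.add polynomial_functions.mult polynomial_functions.const) auto
    have "G x + e * F x \<noteq> 0" if "x \<in> insert k K" for x
    proof
      assume 0: "G x + e * F x = 0"
      show False
      proof (cases "F x = 0")
        case True
        then show False using 0 that F(2) G(3) by auto
      next
        case False
        then have "e = - G x / F x"
          using 0 by (simp add: field_simps eq_neg_iff_add_eq_0)
        then show False using e that by blast
      qed
    qed
    then show "(\<forall>x\<in>Z. G x + e * F x = 0) \<and> (\<forall>x\<in>insert k K. G x + e * F x \<noteq> 0)"
      using G(2) F(1) assms(4) by auto
  qed
qed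

section \<open>Elimination by resultants, and finite projections\<close>

definition adjoin_coords :: "('w \<Rightarrow> complex) set \<Rightarrow> nat \<Rightarrow> ('w \<times> (nat \<Rightarrow> complex) \<Rightarrow> complex) set" where
  "adjoin_coords C k = (\<lambda>c x. c (fst x)) ` C \<union> (\<lambda>i x. snd x i) ` {..<k}"

lemma polynomial_functions_adjoin_fst:
  assumes "F \<in> polynomial_functions C"
  shows "(\<lambda>x. F (fst x)) \<in> polynomial_functions (adjoin_coords C k)"
  by (rule polynomial_functions_comp[OF assms])
    (auto intro: polynomial_functions.coord simp: adjoin_coords_def)

lemma polynomial_functions_adjoin_snd:
  "i < k \<Longrightarrow> (\<lambda>x. snd x i) \<in> polynomial_functions (adjoin_coords C k)"
  by (auto intro: polynomial_functions.coord simp: adjoin_coords_def)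

text \<open>Labellings are total functions, of which only the first \<open>k\<close> values are
  coordinates; this allows passing to their restrictions.\<close>

lemma polynomial_functions_adjoin_cong:
  assumes "F \<in> polynomial_functions (adjoin_coords C k)" and "\<And>i. i < k \<Longrightarrow> z i = z' i"
  shows "F (w, z) = F (w, z')"
  using assms(1) by induction (auto simp: adjoin_coords_def assms(2))

text \<open>The bound \<open>m\<close> is uniform in the parameters. It is what later allows a
  padding to constant degree, hence Sylvester matrices of one fixed size.\<close>

lemma polynomial_functions_expand_last:
  assumes "F \<in> polynomial_functions (adjoin_coords C (Suc k))"
  shows "\<exists>Q m. (\<forall>j. (\<lambda>x. coeff (Q x) j) \<in> polynomial_functions (adjoin_coords C k)) \<and>
    (\<forall>x. degree (Q x) \<le> m) \<and> (\<forall>w z a. F (w, z(k := a)) = poly (Q (w, z)) a)"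
  using assms
proof induction
  case (coord c)
  then consider c' where "c' \<in> C" "c = (\<lambda>x. c' (fst x))" | i where "i < k" "c = (\<lambda>x. snd x i)"
    | "c = (\<lambda>x. snd x k)"
    unfolding adjoin_coords_def lessThan_Suc by blast
  then show ?case
  proof cases
    case 1
    then have "(\<lambda>x. c' (fst x)) \<in> polynomial_functions (adjoin_coords C k)"
      by (intro polynomial_functions_adjoin_fst polynomial_functions.coord)
    then show ?thesis
      using 1(2) by (intro exI[of _ "\<lambda>x. [:c' (fst x):]"] exI[of _ 0] conjI allI, case_tac j)
        (auto intro: polynomial_functions.const)
  next
    case 2
    then show ?thesis
      by (intro exI[of _ "\<lambda>x. [:snd x i:]"] exI[of _ 0] conjI allI, case_tac j)
        (auto intro: polynomial_functions.const polynomial_functions_adjoin_snd)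
  next
    case 3
    then show ?thesis
      by (intro exI[of _ "\<lambda>x. [:0, 1:]"] exI[of _ 1]) (auto intro: polynomial_functions.const)
  qed
next
  case (const a)
  show ?case
    by (intro exI[of _ "\<lambda>x. [:a:]"] exI[of _ 0]) (auto intro: polynomial_functions.const)
next
  case (add F G)
  then obtain Q m Q' m' where
    Q: "\<forall>j. (\<lambda>x. coeff (Q x) j) \<in> polynomial_functions (adjoin_coords C k)"
      "\<forall>x. degree (Q x) \<le> m" "\<forall>w z a. F (w, z(k := a)) = poly (Q (w, z)) a"
    and Q': "\<forall>j. (\<lambda>x. coeff (Q' x) j) \<in> polynomial_functions (adjoin_coords C k)"
      "\<forall>x. degree (Q' x) \<le> m'" "\<forall>w z a. G (w, z(k := a)) = poly (Q' (w, z)) a"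
    by metis
  have "degree (Q x + Q' x) \<le> max m m'" for x
    using Q(2) Q'(2) by (meson degree_add_le max.coboundedI1 max.coboundedI2)
  then show ?case
    using Q Q' by (intro exI[of _ "\<lambda>x. Q x + Q' x"] exI[of _ "max m m'"])
      (auto simp del: fun_upd_apply intro: polynomial_functions.add)
next
  case (mult F G)
  then obtain Q m Q' m' where
    Q: "\<forall>j. (\<lambda>x. coeff (Q x) j) \<in> polynomial_functions (adjoin_coords C k)"
      "\<forall>x. degree (Q x) \<le> m" "\<forall>w z a. F (w, z(k := a)) = poly (Q (w, z)) a"
    and Q': "\<forall>j. (\<lambda>x. coeff (Q' x) j) \<in> polynomial_functions (adjoin_coords C k)"
      "\<forall>x. degree (Q' x) \<le> m'" "\<forall>w z a. G (w, z(k := a)) = poly (Q' (w, z)) a"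
    by metis
  have "degree (Q x * Q' x) \<le> m + m'" for x
    using Q(2) Q'(2) by (meson degree_mult_le add_mono order_trans)
  then show ?case
    using Q Q' by (intro exI[of _ "\<lambda>x. Q x * Q' x"] exI[of _ "m + m'"])
      (auto simp: coeff_mult simp del: fun_upd_apply
        intro!: polynomial_functions_sum polynomial_functions.mult)
qed

lemma resultant_eq_0_iff_common_root:
  fixes p q :: "complex poly"
  assumes "p \<noteq> 0"
  shows "resultant p q = 0 \<longleftrightarrow> (\<exists>z. poly p z = 0 \<and> poly q z = 0)"
proof -
  have "degree (gcd p q) \<noteq> 0 \<longleftrightarrow> (\<exists>z. poly (gcd p q) z = 0)"
  proof
    assume "degree (gcd p q) \<noteq> 0"
    then show "\<exists>z. poly (gcd p q) z = 0"
      by (intro fundamental_theorem_of_algebra) (simp add: constant_degree)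
  next
    assume "\<exists>z. poly (gcd p q) z = 0"
    moreover have "gcd p q \<noteq> 0"
      using assms by simp
    ultimately show "degree (gcd p q) \<noteq> 0"
      by (auto elim!: degree_eq_zeroE)
  qed
  also have "\<dots> \<longleftrightarrow> (\<exists>z. poly p z = 0 \<and> poly q z = 0)"
    by (simp add: poly_eq_0_iff_dvd)
  finally show ?thesis
    using resultant_0_gcd[of p q] by simp
qed

text \<open>Constant degrees fix the size of the Sylvester matrix, and the Leibniz expansion of its
  determinant is then polynomial in the coefficients.\<close>

lemma polynomial_functions_resultant:
  assumes "\<And>j. (\<lambda>x. coeff (P x) j) \<in> polynomial_functions C"
    and "\<And>j. (\<lambda>x. coeff (Q x) j) \<in> polynomial_functions C"
    and "\<And>x. degree (P x) = m" and "\<And>x. degree (Q x) = n"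
  shows "(\<lambda>x. resultant (P x) (Q x)) \<in> polynomial_functions C"
proof -
  have eq: "resultant (P x) (Q x) = (\<Sum>p | p permutes {0..<m + n}. signof p *
      (\<Prod>i = 0..<m + n. sylvester_mat_sub m n (P x) (Q x) $$ (i, p i)))" for x
    unfolding resultant_sub resultant_sub_def assms(3,4)
    by (rule det_def'[OF sylvester_mat_sub_carrier])
  show ?thesis
    unfolding eq
  proof (intro polynomial_functions_sum polynomial_functions.mult polynomial_functions_prod
      polynomial_functions.const)
    fix p i
    assume "p \<in> {p. p permutes {0..<m + n}}" "i \<in> {0..<m + n}"
    then have "i < m + n" "p i < m + n"
      using permutes_in_image by fastforce+
    then show "(\<lambda>x. sylvester_mat_sub m n (P x) (Q x) $$ (i, p i)) \<in> polynomial_functions C"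
      by (simp only: sylvester_mat_sub_index)
        (intro polynomial_functions_if assms polynomial_functions.const)
  qed
qed

text \<open>\<open>N\<close> is the resultant of \<open>P w\<close> with \<open>G\<close>, read as a
  polynomial in its last coordinate; over the complex numbers its vanishing means a common
  root.\<close>

lemma eliminate_last_coord:
  assumes P: "\<And>j. (\<lambda>w. coeff (P w) j) \<in> polynomial_functions C"
      "\<And>w. degree (P w) = M" "\<And>w. lead_coeff (P w) = 1"
    and G: "G \<in> polynomial_functions (adjoin_coords C (Suc k))"
  shows "\<exists>N\<in>polynomial_functions (adjoin_coords C k).
    \<forall>w z. N (w, z) = 0 \<longleftrightarrow> (\<exists>a. poly (P w) a = 0 \<and> G (w, z(k := a)) = 0)"
proof -
  have nz: "P w \<noteq> 0" for w
    using P(3)[of w] by auto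
  obtain Q m where
    Q: "\<forall>j. (\<lambda>x. coeff (Q x) j) \<in> polynomial_functions (adjoin_coords C k)"
      "\<forall>x. degree (Q x) \<le> m" "\<forall>w z a. G (w, z(k := a)) = poly (Q (w, z)) a"
    using polynomial_functions_expand_last[OF G] by blast
  \<comment> \<open>Adding a multiple of \<open>P\<close> keeps the common roots and makes the degree constant.\<close>
  define Q' where "Q' x = Q x + monom 1 (Suc m) * P (fst x)" for x
  have deg: "degree (Q' x) = Suc m + M" for x
  proof -
    have "degree (monom 1 (Suc m) * P (fst x)) = Suc m + M"
      using P(2) nz by (subst degree_mult_eq) (auto simp: degree_monom_eq)
    moreover have "degree (Q x) < Suc m + M"
      using Q(2) by (meson le_imp_less_Suc less_le_trans le_add1)
    ultimately show ?thesis
      unfolding Q'_def by (simp add: degree_add_eq_right)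
  qed
  have "(\<lambda>x. resultant (P (fst x)) (Q' x)) \<in> polynomial_functions (adjoin_coords C k)"
  proof (rule polynomial_functions_resultant)
    show "(\<lambda>x. coeff (P (fst x)) j) \<in> polynomial_functions (adjoin_coords C k)" for j
      by (rule polynomial_functions_adjoin_fst[OF P(1)])
    show "(\<lambda>x. coeff (Q' x) j) \<in> polynomial_functions (adjoin_coords C k)" for j
      unfolding Q'_def coeff_add coeff_mult coeff_monom
      by (intro polynomial_functions.add polynomial_functions_sum polynomial_functions.mult
        polynomial_functions.const polynomial_functions_adjoin_fst P(1) Q(1)[rule_format])
  qed (rule P(2) deg)+
  moreover have "resultant (P w) (Q' (w, z)) = 0 \<longleftrightarrow>
      (\<exists>a. poly (P w) a = 0 \<and> G (w, z(k := a)) = 0)" for w z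
    unfolding resultant_eq_0_iff_common_root[OF nz] Q'_def Q(3)[rule_format]
    by (auto simp: poly_monom)
  ultimately show ?thesis
    by (intro bexI[of _ "\<lambda>x. resultant (P (fst x)) (Q' x)"]) (simp_all only: fst_conv simp_thms)
qed

text \<open>Repeated resultants produce the norm of \<open>G\<close>: up to sign, \<open>N w\<close>
  is the product of \<open>G (w, a)\<close> over all \<open>k\<close>-tuples \<open>a\<close> of
  roots of \<open>P w\<close>, with multiplicity.\<close>

lemma eliminate_coords:
  assumes P: "\<And>j. (\<lambda>w. coeff (P w) j) \<in> polynomial_functions C"
      "\<And>w. degree (P w) = M" "\<And>w. lead_coeff (P w) = 1"
    and G: "G \<in> polynomial_functions (adjoin_coords C k)"
  shows "\<exists>N\<in>polynomial_functions C. \<forall>w. N w = 0 \<longleftrightarrow>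
    (\<exists>a\<in>{..<k} \<rightarrow>\<^sub>E {a. poly (P w) a = 0}. G (w, a) = 0)"
  using G
proof (induction k arbitrary: G)
  case 0
  \<comment> \<open>With no coordinates left, \<open>\<lambda>_. undefined\<close> is the only
    element of the extensional function space.\<close>
  have "(\<lambda>w. G (w, \<lambda>_. undefined)) \<in> polynomial_functions C"
    by (rule polynomial_functions_comp[OF 0]) (auto simp: adjoin_coords_def polynomial_functions.coord)
  then show ?case by (rule bexI[rotated]) simp
next
  case (Suc k)
  obtain N where N: "N \<in> polynomial_functions (adjoin_coords C k)"
      "\<forall>w z. N (w, z) = 0 \<longleftrightarrow> (\<exists>a. poly (P w) a = 0 \<and> G (w, z(k := a)) = 0)"
    using eliminate_last_coord[OF P Suc.prems] by blast
  obtain N' where N': "N' \<in> polynomial_functions C" "\<forall>w. N' w = 0 \<longleftrightarrow>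
      (\<exists>a\<in>{..<k} \<rightarrow>\<^sub>E {a. poly (P w) a = 0}. N (w, a) = 0)"
    using Suc.IH[OF N(1)] by blast
  show ?case
  proof (rule bexI[OF _ N'(1)], rule allI)
    fix w
    have "(\<exists>a\<in>{..<Suc k} \<rightarrow>\<^sub>E {a. poly (P w) a = 0}. G (w, a) = 0) \<longleftrightarrow>
        (\<exists>b\<in>{..<k} \<rightarrow>\<^sub>E {a. poly (P w) a = 0}. \<exists>y. poly (P w) y = 0 \<and> G (w, b(k := y)) = 0)"
      unfolding lessThan_Suc PiE_insert_eq bex_simps(7) Bex_def mem_Times_iff
      by (simp del: fun_upd_apply PiE_iff) blast
    then show "N' w = 0 \<longleftrightarrow> (\<exists>a\<in>{..<Suc k} \<rightarrow>\<^sub>E {a. poly (P w) a = 0}. G (w, a) = 0)"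
      unfolding N'(2)[rule_format] N(2)[rule_format] by (rule sym)
  qed
qed

text \<open>The projection forgetting roots of a monic polynomial is finite, hence closed.\<close>

lemma closedin_image_fst_roots:
  assumes P: "\<And>j. (\<lambda>w. coeff (P w) j) \<in> polynomial_functions C"
      "\<And>w. degree (P w) = M" "\<And>w. lead_coeff (P w) = 1"
    and Z: "closedin (zariski (adjoin_coords C k) UNIV) Z"
    and roots: "\<And>w z i. (w, z) \<in> Z \<Longrightarrow> i < k \<Longrightarrow> poly (P w) (z i) = 0"
  shows "closedin (zariski C UNIV) (fst ` Z)"
proof (rule closedin_zariskiI)
  fix w
  assume w: "w \<in> UNIV - fst ` Z"
  obtain S where S: "S \<subseteq> polynomial_functions (adjoin_coords C k)" "Z = {x. \<forall>F\<in>S. F x = 0}"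
    using Z unfolding closedin_zariski by auto
  \<comment> \<open>The finitely many tuples of roots over \<open>w\<close>. None lies in
    \<open>Z\<close>, so one \<open>G\<close> can vanish on \<open>Z\<close> and at no point of
    \<open>K\<close>; its norm then vanishes on the projection of \<open>Z\<close> but not at
    \<open>w\<close>.\<close>
  define K where "K = {w} \<times> ({..<k} \<rightarrow>\<^sub>E {a. poly (P w) a = 0})"
  have "P w \<noteq> 0"
    using P(3)[of w] by auto
  then have "finite K"
    unfolding K_def by (intro finite_cartesian_product finite_PiE) (auto simp: poly_roots_finite)
  moreover have "\<exists>F\<in>S. F x \<noteq> 0" if "x \<in> K" for x
  proof -
    have "x \<notin> Z" using that w unfolding K_def by force
    then show ?thesis unfolding S(2) by blast
  qed
  moreover have "F x = 0" if "F \<in> S" "x \<in> Z" for F x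
    using that unfolding S(2) by blast
  ultimately have "\<exists>G\<in>polynomial_functions (adjoin_coords C k). (\<forall>x\<in>Z. G x = 0) \<and> (\<forall>x\<in>K. G x \<noteq> 0)"
    using S(1) by (intro nonvanishing_combination)
  then obtain G where G: "G \<in> polynomial_functions (adjoin_coords C k)" "\<forall>x\<in>Z. G x = 0"
      "\<forall>x\<in>K. G x \<noteq> 0"
    by blast
  obtain N where N: "N \<in> polynomial_functions C"
      "\<forall>w. N w = 0 \<longleftrightarrow> (\<exists>a\<in>{..<k} \<rightarrow>\<^sub>E {a. poly (P w) a = 0}. G (w, a) = 0)"
    using eliminate_coords[OF P G(1)] by blast
  have "N (fst x) = 0" if "x \<in> Z" for x
  proof -
    obtain v z where x: "x = (v, z)" by (cases x)
    \<comment> \<open>Elements of \<open>Z\<close> may take any values from index \<open>k\<close>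
      on, whereas the norm ranges over extensional tuples.\<close>
    have "G (v, restrict z {..<k}) = G (v, z)"
      by (rule polynomial_functions_adjoin_cong[OF G(1)]) simp
    moreover have "restrict z {..<k} \<in> {..<k} \<rightarrow>\<^sub>E {a. poly (P v) a = 0}"
      using roots that unfolding x by auto
    ultimately show ?thesis
      using G(2) that unfolding x fst_conv N(2)[rule_format] by metis
  qed
  moreover have "N w \<noteq> 0"
    using G(3) unfolding K_def N(2)[rule_format] by blast
  ultimately show "\<exists>F\<in>polynomial_functions C. (\<forall>x\<in>fst ` Z. F x = 0) \<and> F w \<noteq> 0"
    using N(1) by blast
qed auto

section \<open>Generic points and irreducible components\<close>

lemma subtopology_zariski:
  assumes "A \<subseteq> W"
  shows "subtopology (zariski C W) A = zariski C A"
proof (rule topology_eq[THEN iffD2], rule allI)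
  fix U
  have "{w \<in> W. \<exists>F\<in>S. F w \<noteq> 0} \<inter> A = {w \<in> A. \<exists>F\<in>S. F w \<noteq> 0}" for S :: "('a \<Rightarrow> complex) set"
    using assms by auto
  then show "openin (subtopology (zariski C W) A) U = openin (zariski C A) U"
    unfolding openin_subtopology openin_zariski by auto
qed

lemma polynomial_functions_poly_curve:
  fixes h :: "complex \<Rightarrow> 'w"
  assumes "F \<in> polynomial_functions C"
    and "\<And>c. c \<in> C \<Longrightarrow> \<exists>p. \<forall>t. c (h t) = poly p t"
  shows "\<exists>p. \<forall>t. F (h t) = poly p t"
  using assms(1)
proof induction
  case (coord c)
  then show ?case by (rule assms(2))
next
  case (const a)
  show ?case by (rule exI[of _ "[:a:]"]) simp
next
  case (add F G)
  then show ?case by (metis poly_add)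
next
  case (mult F G)
  then show ?case by (metis poly_mult)
qed

text \<open>Let an open set around \<open>f \<in> I\<close> contain the locus
  \<open>F \<noteq> 0\<close>, where \<open>F f \<noteq> 0\<close>. Along the curve from
  \<open>f0\<close> to \<open>f\<close>, both \<open>F\<close> and \<open>H\<close> are univariate
  polynomials, nonzero because \<open>F\<close> does not vanish at time 1 nor \<open>H\<close> at
  time 0. So their product is nonzero at some time, and the locus \<open>H \<noteq> 0\<close> is
  dense in \<open>I\<close>, hence in its closure.\<close>

lemma generically_closure_ofI:
  fixes h :: "'w \<Rightarrow> complex \<Rightarrow> 'w"
  assumes I: "I \<subseteq> W" "f0 \<in> I"
    and H: "H \<in> polynomial_functions C" "H f0 \<noteq> 0"
    and h: "\<And>f. f \<in> I \<Longrightarrow> h f 0 = f0" "\<And>f. f \<in> I \<Longrightarrow> h f 1 = f" "\<And>f t. f \<in> I \<Longrightarrow> h f t \<in> I"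
      "\<And>f c. f \<in> I \<Longrightarrow> c \<in> C \<Longrightarrow> \<exists>p. \<forall>t. c (h f t) = poly p t"
    and P: "\<And>f. f \<in> zariski C W closure_of I \<Longrightarrow> H f \<noteq> 0 \<Longrightarrow> P f"
  shows "generically (subtopology (zariski C W) (zariski C W closure_of I)) P"
proof -
  let ?X = "zariski C W closure_of I"
  define U where "U = {f \<in> ?X. H f \<noteq> 0}"
  have XW: "?X \<subseteq> W"
    using closure_of_subset_topspace[of "zariski C W" I] by simp
  have IX: "I \<subseteq> ?X"
    using I(1) by (intro closure_of_subset) simp
  have "I \<subseteq> zariski C ?X closure_of U"
  proof
    fix f assume f: "f \<in> I"
    show "f \<in> zariski C ?X closure_of U"
      unfolding in_closure_of[of f "zariski C ?X" U] topspace_zariski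
    proof (intro conjI allI impI)
      show "f \<in> ?X" using f IX by blast
    next
      fix T assume "f \<in> T \<and> openin (zariski C ?X) T"
      then obtain F where F: "F \<in> polynomial_functions C" "F f \<noteq> 0" "\<And>w. w \<in> ?X \<Longrightarrow> F w \<noteq> 0 \<Longrightarrow> w \<in> T"
        unfolding openin_zariski by blast
      obtain p where p: "\<And>t. F (h f t) = poly p t"
        using polynomial_functions_poly_curve[where h = "h f", OF F(1) h(4)[OF f]] by blast
      obtain q where q: "\<And>t. H (h f t) = poly q t"
        using polynomial_functions_poly_curve[where h = "h f", OF H(1) h(4)[OF f]] by blast
      have "p \<noteq> 0" using p[of 1] h(2)[OF f] F(2) by auto
      moreover have "q \<noteq> 0" using q[of 0] h(1)[OF f] H(2) by auto
      ultimately have "p * q \<noteq> 0" by simp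
      then obtain t where "poly (p * q) t \<noteq> 0"
        using poly_all_0_iff_0 by blast
      then have "F (h f t) \<noteq> 0" "H (h f t) \<noteq> 0"
        unfolding p q by auto
      moreover have "h f t \<in> ?X"
        using h(3)[OF f] IX by blast
      ultimately show "\<exists>y. y \<in> U \<and> y \<in> T"
        unfolding U_def using F(3) by blast
    qed
  qed
  moreover have "zariski C ?X closure_of U = zariski C W closure_of U"
  proof -
    have "zariski C ?X closure_of U = ?X \<inter> zariski C W closure_of U"
      unfolding subtopology_zariski[OF XW, symmetric] closure_of_subtopology
      by (simp add: U_def Int_absorb1 subset_iff)
    also have "\<dots> = zariski C W closure_of U"
      by (intro Int_absorb1 closure_of_minimal) (auto simp: U_def)
    finally show ?thesis .
  qed
  ultimately have "?X \<subseteq> zariski C ?X closure_of U"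
    by (metis closedin_closure_of closure_of_minimal)
  then have "zariski C ?X closure_of U = ?X"
    using closure_of_subset_topspace[of "zariski C ?X" U] by auto
  moreover have "openin (zariski C ?X) U"
    unfolding openin_zariski U_def using H(1) by (intro exI[of _ "{H}"]) auto
  ultimately show ?thesis
    unfolding generically_def subtopology_zariski[OF XW] using P by (auto simp: U_def)
qed

section \<open>Irreducible components and irreducible curves\<close>

lemma irreducible_spaceD:
  assumes "irreducible_space (subtopology X Z)" and "Z \<subseteq> A \<union> B"
    and "closedin X A" and "closedin X B" and "Z \<subseteq> topspace X"
  shows "Z \<subseteq> A \<or> Z \<subseteq> B"
proof -
  have "closedin (subtopology X Z) (Z \<inter> A)" "closedin (subtopology X Z) (Z \<inter> B)"
    using assms(3,4) by (auto simp: closedin_subtopology)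
  moreover have "topspace (subtopology X Z) = Z \<inter> A \<union> Z \<inter> B"
    using assms(2,5) by auto
  ultimately have "Z \<inter> A = topspace (subtopology X Z) \<or> Z \<inter> B = topspace (subtopology X Z)"
    using assms(1) unfolding irreducible_space_def by blast
  then show ?thesis using assms(5) by auto
qed

text \<open>An irreducible subset lies in one of the closed sets \<open>A\<close> and
  \<open>B\<close>. Neither contains the other, as they are disjoint and nonempty, so both are
  maximal and nothing else is.\<close>

lemma irreducible_components_disjoint_Un:
  assumes X: "topspace X = A \<union> B" "A \<inter> B = {}"
    and cl: "closedin X A" "closedin X B"
    and irr: "irreducible_space (subtopology X A)" "irreducible_space (subtopology X B)"
  shows "irreducible_components X = {A, B}"
proof -
  have ne: "A \<noteq> {}" "B \<noteq> {}"
    using irr unfolding irreducible_space_def by auto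
  have dich: "Z \<subseteq> A \<or> Z \<subseteq> B"
    if "Z \<subseteq> topspace X" "irreducible_space (subtopology X Z)" for Z
    using irreducible_spaceD[OF that(2) _ cl] that(1) X(1) by blast
  show ?thesis
  proof (rule Set.set_eqI)
    fix Z
    show "Z \<in> irreducible_components X \<longleftrightarrow> Z \<in> {A, B}"
    proof
      assume "Z \<in> irreducible_components X"
      then have Z: "Z \<subseteq> topspace X" "irreducible_space (subtopology X Z)"
        "\<And>Z'. Z \<subseteq> Z' \<Longrightarrow> Z' \<subseteq> topspace X \<Longrightarrow> irreducible_space (subtopology X Z') \<Longrightarrow> Z' = Z"
        unfolding irreducible_components_def by auto
      have "Z = A" if "Z \<subseteq> A"
        using Z(3)[OF that _ irr(1)] X(1) by auto
      moreover have "Z = B" if "Z \<subseteq> B"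
        using Z(3)[OF that _ irr(2)] X(1) by auto
      ultimately show "Z \<in> {A, B}"
        using dich[OF Z(1,2)] by blast
    next
      have "Z' = A" if "A \<subseteq> Z'" "Z' \<subseteq> topspace X" "irreducible_space (subtopology X Z')" for Z'
        using dich[OF that(2,3)] that(1) ne X(2) by blast
      moreover have "Z' = B" if "B \<subseteq> Z'" "Z' \<subseteq> topspace X" "irreducible_space (subtopology X Z')" for Z'
        using dich[OF that(2,3)] that(1) ne X(2) by blast
      ultimately have "A \<in> irreducible_components X" "B \<in> irreducible_components X"
        unfolding irreducible_components_def using irr X(1) by blast+
      then show "Z \<in> {A, B} \<Longrightarrow> Z \<in> irreducible_components X" by blast
    qed
  qed
qed

lemma polynomial_functions_laurent_curve:
  fixes h :: "complex \<Rightarrow> 'w"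
  assumes "F \<in> polynomial_functions C"
    and "\<And>c. c \<in> C \<Longrightarrow> \<exists>p e. \<forall>t. t \<noteq> 0 \<longrightarrow> c (h t) * t ^ e = poly p t"
  shows "\<exists>p e. \<forall>t. t \<noteq> 0 \<longrightarrow> F (h t) * t ^ e = poly p t"
  using assms(1)
proof induction
  case (coord c)
  then show ?case by (rule assms(2))
next
  case (const a)
  show ?case by (intro exI[of _ "[:a:]"] exI[of _ 0]) simp
next
  case (add F G)
  then obtain p e q k where p: "\<forall>t. t \<noteq> 0 \<longrightarrow> F (h t) * t ^ e = poly p t"
    and q: "\<forall>t. t \<noteq> 0 \<longrightarrow> G (h t) * t ^ k = poly q t" by blast
  show ?case
    by (intro exI[of _ "p * monom 1 k + q * monom 1 e"] exI[of _ "e + k"] allI impI)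
      (simp add: poly_monom p[rule_format, symmetric] q[rule_format, symmetric] power_add algebra_simps)
next
  case (mult F G)
  then obtain p e q k where p: "\<forall>t. t \<noteq> 0 \<longrightarrow> F (h t) * t ^ e = poly p t"
    and q: "\<forall>t. t \<noteq> 0 \<longrightarrow> G (h t) * t ^ k = poly q t" by blast
  show ?case
    by (intro exI[of _ "p * q"] exI[of _ "e + k"] allI impI)
      (simp add: p[rule_format, symmetric] q[rule_format, symmetric] power_add algebra_simps)
qed

text \<open>The curve is an image of the punctured line. Functions on it are Laurent polynomials in
  \<open>t\<close>, which become polynomials after multiplication by a power of \<open>t\<close> and
  so have no zero divisors.\<close>

lemma irreducible_space_laurent_curve:
  fixes h :: "complex \<Rightarrow> 'w"
  assumes "\<And>c. c \<in> C \<Longrightarrow> \<exists>p e. \<forall>t. t \<noteq> 0 \<longrightarrow> c (h t) * t ^ e = poly p t"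
  shows "irreducible_space (zariski C (h ` (- {0})))"
  unfolding irreducible_space_def topspace_zariski
proof (intro conjI allI impI)
  show "h ` (- {0}) \<noteq> {}"
    using one_neq_zero[where ?'a = complex] by blast
next
  fix A B
  assume A: "closedin (zariski C (h ` (- {0}))) A" and B: "closedin (zariski C (h ` (- {0}))) B"
    and AB: "h ` (- {0}) = A \<union> B"
  show "A = h ` (- {0}) \<or> B = h ` (- {0})"
  proof (rule ccontr)
    assume "\<not> (A = h ` (- {0}) \<or> B = h ` (- {0}))"
    then obtain s t where s: "s \<noteq> 0" "h s \<notin> A" and t: "t \<noteq> 0" "h t \<notin> B"
      using AB by blast
    obtain F where F: "F \<in> polynomial_functions C" "F (h s) \<noteq> 0" "\<forall>x\<in>A. F x = 0"
      using A s unfolding closedin_zariski by blast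
    obtain G where G: "G \<in> polynomial_functions C" "G (h t) \<noteq> 0" "\<forall>x\<in>B. G x = 0"
      using B t unfolding closedin_zariski by blast
    obtain p e where p: "\<And>t. t \<noteq> 0 \<Longrightarrow> F (h t) * t ^ e = poly p t"
      using polynomial_functions_laurent_curve[where h = h, OF F(1) assms] by blast
    obtain q k where q: "\<And>t. t \<noteq> 0 \<Longrightarrow> G (h t) * t ^ k = poly q t"
      using polynomial_functions_laurent_curve[where h = h, OF G(1) assms] by blast
    \<comment> \<open>The factor \<open>[:0, 1:]\<close> takes care of the excluded parameter
      0.\<close>
    have "poly (p * q * [:0, 1:]) t = 0" for t
    proof (cases "t = 0")
      case False
      then have "F (h t) = 0 \<or> G (h t) = 0"
        using AB F(3) G(3) by blast
      then show ?thesis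
        using p[OF False] q[OF False] by auto
    qed simp
    then have "p * q * [:0, 1:] = 0"
      using poly_all_0_iff_0 by blast
    then have "p = 0 \<or> q = 0" by simp
    then show False
      using p[OF s(1)] q[OF t(1)] F(2) G(2) s(1) t(1) by auto
  qed
qed

section \<open>Forms and the Kronecker substitution\<close>

lemma lookup_single_0_mult:
  "Poly_Mapping.lookup (Poly_Mapping.single 0 c * p) a = c * Poly_Mapping.lookup p a"
  for p :: "'a :: monoid_add \<Rightarrow>\<^sub>0 'b :: semiring_0"
  unfolding mult_map_scale_conv_mult[symmetric] by transfer (simp add: when_def)

lemma poly_mapping_sum_single:
  "p = (\<Sum>a\<in>Poly_Mapping.keys p. Poly_Mapping.single a (Poly_Mapping.lookup p a))"
  by (rule poly_mapping_eqI)
    (auto simp: lookup_sum lookup_single when_def in_keys_iff)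

text \<open>The map \<open>m\<close> receives exponent and coefficient together, so that both
  Kronecker substitutions below are instances.\<close>

definition linear_extension :: "('a \<Rightarrow> 'b \<Rightarrow> 'c) \<Rightarrow> ('a \<Rightarrow>\<^sub>0 'b :: zero) \<Rightarrow> 'c :: comm_monoid_add" where
  "linear_extension m p = (\<Sum>a\<in>Poly_Mapping.keys p. m a (Poly_Mapping.lookup p a))"

lemma linear_extension_superset:
  assumes "finite A" and "Poly_Mapping.keys p \<subseteq> A" and "\<And>a. m a 0 = 0"
  shows "linear_extension m p = (\<Sum>a\<in>A. m a (Poly_Mapping.lookup p a))"
  unfolding linear_extension_def
  by (rule sum.mono_neutral_left) (use assms in \<open>auto simp: in_keys_iff\<close>)

lemma linear_extension_0 [simp]: "linear_extension m 0 = 0"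
  by (simp add: linear_extension_def)

lemma linear_extension_single:
  assumes "\<And>a. m a 0 = 0"
  shows "linear_extension m (Poly_Mapping.single a c) = m a c"
  by (subst linear_extension_superset[of "{a}"]) (auto simp: assms)

lemma linear_extension_add:
  assumes "\<And>a. m a 0 = 0" and "\<And>a c d. m a (c + d) = m a c + m a d"
  shows "linear_extension m (p + q) = linear_extension m p + linear_extension m q"
proof -
  let ?A = "Poly_Mapping.keys p \<union> Poly_Mapping.keys q"
  show ?thesis
    using keys_add[of p q] assms
    by (simp add: linear_extension_superset[of ?A] lookup_add sum.distrib)
qed

lemma linear_extension_sum:
  assumes "\<And>a. m a 0 = 0" and "\<And>a c d. m a (c + d) = m a c + m a d"
  shows "linear_extension m (\<Sum>i\<in>I. p i) = (\<Sum>i\<in>I. linear_extension m (p i))"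
  by (induction I rule: infinite_finite_induct) (auto simp: linear_extension_add[OF assms])

lemma linear_extension_mult:
  fixes m :: "'a :: monoid_add \<Rightarrow> 'b :: comm_semiring_0 \<Rightarrow> 'c :: comm_semiring_0"
  assumes "\<And>a. m a 0 = 0" and "\<And>a c d. m a (c + d) = m a c + m a d"
    and "\<And>a b c d. m (a + b) (c * d) = m a c * m b d"
  shows "linear_extension m (p * q) = linear_extension m p * linear_extension m q"
proof -
  have "p * q = (\<Sum>a\<in>Poly_Mapping.keys p. \<Sum>b\<in>Poly_Mapping.keys q.
      Poly_Mapping.single (a + b) (Poly_Mapping.lookup p a * Poly_Mapping.lookup q b))"
    by (subst poly_mapping_sum_single[of p], subst poly_mapping_sum_single[of q])
      (simp add: sum_product mult_single)
  then have "linear_extension m (p * q) = (\<Sum>a\<in>Poly_Mapping.keys p. \<Sum>b\<in>Poly_Mapping.keys q.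
      m a (Poly_Mapping.lookup p a) * m b (Poly_Mapping.lookup q b))"
    by (simp add: linear_extension_sum assms linear_extension_single)
  then show ?thesis
    by (simp add: linear_extension_def sum_product)
qed

section \<open>Forms, their monomials and their weights\<close>

definition Mon :: "nat \<Rightarrow> nat \<Rightarrow> (nat \<Rightarrow>\<^sub>0 nat) set" where
  "Mon n m = {a. Poly_Mapping.keys a \<subseteq> {0..n} \<and> (\<Sum>i=0..n. Poly_Mapping.lookup a i) = m}"

lemma Sym_iff: "p \<in> Sym n m \<longleftrightarrow> Poly_Mapping.keys p \<subseteq> Mon n m"
  unfolding Sym_def Mon_def by auto

lemma Mon_add: "a \<in> Mon n k \<Longrightarrow> b \<in> Mon n m \<Longrightarrow> a + b \<in> Mon n (k + m)"
  using keys_add[of a b] by (auto simp: Mon_def lookup_add sum.distrib)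

lemma Sym_0 [simp]: "0 \<in> Sym n m"
  by (simp add: Sym_iff)

lemma Sym_add: "p \<in> Sym n m \<Longrightarrow> q \<in> Sym n m \<Longrightarrow> p + q \<in> Sym n m"
  using keys_add[of p q] by (auto simp: Sym_iff)

lemma Sym_sum: "(\<And>i. i \<in> I \<Longrightarrow> p i \<in> Sym n m) \<Longrightarrow> (\<Sum>i\<in>I. p i) \<in> Sym n m"
  by (induction I rule: infinite_finite_induct) (auto intro: Sym_add)

lemma Sym_single: "a \<in> Mon n m \<Longrightarrow> Poly_Mapping.single a c \<in> Sym n m"
  by (simp add: Sym_iff)

lemma Sym_mult: "p \<in> Sym n k \<Longrightarrow> q \<in> Sym n m \<Longrightarrow> p * q \<in> Sym n (k + m)"
  using keys_mult[of p q] Mon_add unfolding Sym_iff by blast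

lemma Sym_scale: "p \<in> Sym n m \<Longrightarrow> Poly_Mapping.single 0 c * p \<in> Sym n m"
  using Sym_mult[of "Poly_Mapping.single 0 c" n 0 p m] by (simp add: Sym_single Mon_def)

lemma Sym_diff: "p \<in> Sym n m \<Longrightarrow> q \<in> Sym n m \<Longrightarrow> p - q \<in> Sym n m"
  using keys_diff[of p q] by (auto simp: Sym_iff)

text \<open>
  Kronecker substitution: \<open>x\<^sub>i\<close> becomes \<open>t\<^bsup>B\<^sup>i\<^esup>\<close> for \<open>i < n\<close>, and \<open>x\<^sub>n\<close> becomes \<open>1\<close>. Since exponents
  below \<open>B\<close> are the digits of their weight, no information on forms of degree less than \<open>B\<close> is lost.
\<close>

definition wt :: "nat \<Rightarrow> nat \<Rightarrow> (nat \<Rightarrow>\<^sub>0 nat) \<Rightarrow> nat" where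
  "wt B n a = (\<Sum>i<n. Poly_Mapping.lookup a i * B ^ i)"

definition kron :: "nat \<Rightarrow> nat \<Rightarrow> cpoly \<Rightarrow> complex poly" where
  "kron B n = linear_extension (\<lambda>a c. Polynomial.monom c (wt B n a))"

lemma wt_add: "wt B n (a + b) = wt B n a + wt B n b"
  by (simp add: wt_def lookup_add sum.distrib algebra_simps)

lemma wt_single: "wt B n (Poly_Mapping.single i k) = (if i < n then k * B ^ i else 0)"
proof -
  have "Poly_Mapping.lookup (Poly_Mapping.single i k) j * B ^ j = (if j = i then k * B ^ i else 0)" for j
    by (auto simp: lookup_single when_def)
  then show ?thesis by (simp add: wt_def)
qed

lemma kron_0 [simp]: "kron B n 0 = 0"
  by (simp add: kron_def)

lemma kron_add: "kron B n (p + q) = kron B n p + kron B n q"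
  unfolding kron_def by (rule linear_extension_add) (auto simp: add_monom)

lemma kron_mult: "kron B n (p * q) = kron B n p * kron B n q"
  unfolding kron_def by (rule linear_extension_mult) (auto simp: add_monom mult_monom wt_add)

lemma kron_single: "kron B n (Poly_Mapping.single a c) = Polynomial.monom c (wt B n a)"
  unfolding kron_def by (rule linear_extension_single) simp

lemma kron_sum: "kron B n (\<Sum>i\<in>I. p i) = (\<Sum>i\<in>I. kron B n (p i))"
  unfolding kron_def by (rule linear_extension_sum) (auto simp: add_monom)

lemma digits_unique:
  fixes x y :: "nat \<Rightarrow> nat"
  assumes "\<And>i. i < n \<Longrightarrow> x i < B" "\<And>i. i < n \<Longrightarrow> y i < B"
    and "(\<Sum>i<n. x i * B ^ i) = (\<Sum>i<n. y i * B ^ i)" and "i < n"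
  shows "x i = y i"
  using assms
proof (induction n arbitrary: i)
  case (Suc n)
  have less: "(\<Sum>i<n. z i * B ^ i) < B ^ n" if "\<And>i. i < n \<Longrightarrow> z i < B" for z :: "nat \<Rightarrow> nat"
    using that
  proof (induction n)
    case (Suc n)
    have "(\<Sum>i<n. z i * B ^ i) < B ^ n" using Suc by simp
    moreover have "Suc (z n) * B ^ n \<le> B * B ^ n"
      using Suc.prems[of n] by (intro mult_right_mono) auto
    ultimately show ?case by simp
  qed simp
  \<comment> \<open>The lower digits sum to less than \<open>B ^ n\<close>, so division by
    \<open>B ^ n\<close> isolates the top digit.\<close>
  have digit: "(\<Sum>i<Suc n. z i * B ^ i) div B ^ n = z n" if "\<And>i. i < Suc n \<Longrightarrow> z i < B"
    for z :: "nat \<Rightarrow> nat"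
  proof -
    have "(\<Sum>i<n. z i * B ^ i) < B ^ n"
      using that by (intro less) simp
    moreover from this have "B ^ n \<noteq> 0" by linarith
    ultimately show ?thesis
      unfolding sum.lessThan_Suc by (subst div_mult_self1) simp_all
  qed
  have "x n = y n"
    using digit[of x] digit[of y] Suc.prems by simp
  moreover have "x i = y i" if "i < n"
    using Suc.IH[of i] Suc.prems \<open>x n = y n\<close> that by simp
  ultimately show ?case
    using Suc.prems(4) less_Suc_eq by auto
qed simp

lemma Mon_lookup_le:
  assumes "a \<in> Mon n m"
  shows "Poly_Mapping.lookup a i \<le> m"
proof (cases "i \<in> Poly_Mapping.keys a")
  case True
  then have "i \<in> {0..n}" using assms by (auto simp: Mon_def)
  then have "Poly_Mapping.lookup a i \<le> (\<Sum>i=0..n. Poly_Mapping.lookup a i)"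
    by (intro member_le_sum) auto
  then show ?thesis using assms by (simp add: Mon_def)
qed (simp add: in_keys_iff)

text \<open>The weight has the exponents of all variables except the last as its digits in base
  \<open>B\<close>; the last exponent is recovered from the total degree.\<close>

lemma inj_on_wt:
  assumes "m < B"
  shows "inj_on (wt B n) (Mon n m)"
proof (rule inj_onI)
  fix a b
  assume a: "a \<in> Mon n m" and b: "b \<in> Mon n m" and eq: "wt B n a = wt B n b"
  have lt: "Poly_Mapping.lookup a i = Poly_Mapping.lookup b i" if "i < n" for i
    using digits_unique[OF _ _ eq[unfolded wt_def] that] Mon_lookup_le[OF a] Mon_lookup_le[OF b] assms
    by (meson le_less_trans)
  have split: "(\<Sum>i=0..n. Poly_Mapping.lookup c i) = (\<Sum>i<n. Poly_Mapping.lookup c i) + Poly_Mapping.lookup c n"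
    for c :: "nat \<Rightarrow>\<^sub>0 nat"
    by (simp add: atLeast0AtMost lessThan_Suc_atMost[symmetric])
  show "a = b"
  proof (rule poly_mapping_eqI)
    fix i
    consider "i < n" | "i = n" | "i > n" by linarith
    then show "Poly_Mapping.lookup a i = Poly_Mapping.lookup b i"
    proof cases
      case 1 then show ?thesis by (rule lt)
    next
      case 2
      have "(\<Sum>i<n. Poly_Mapping.lookup a i) = (\<Sum>i<n. Poly_Mapping.lookup b i)"
        using lt by simp
      then show ?thesis
        using a b split[of a] split[of b] 2 by (simp add: Mon_def)
    next
      case 3
      then have "i \<notin> Poly_Mapping.keys a" "i \<notin> Poly_Mapping.keys b"
        using a b by (auto simp: Mon_def)
      then show ?thesis by (simp add: in_keys_iff)
    qed
  qed
qed

lemma wt_le: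
  assumes "a \<in> Mon n m" and "B > 0"
  shows "wt B n a \<le> m * B ^ (n - 1)"
proof -
  have "wt B n a \<le> (\<Sum>i<n. Poly_Mapping.lookup a i * B ^ (n - 1))"
    unfolding wt_def using assms(2) by (intro sum_mono mult_left_mono power_increasing) auto
  also have "\<dots> \<le> (\<Sum>i=0..n. Poly_Mapping.lookup a i * B ^ (n - 1))"
    by (intro sum_mono2) auto
  also have "\<dots> = m * B ^ (n - 1)"
    using assms(1) by (simp add: Mon_def sum_distrib_right[symmetric])
  finally show ?thesis .
qed

lemma coeff_kron:
  assumes "p \<in> Sym n m" and "m < B" and "a \<in> Mon n m"
  shows "coeff (kron B n p) (wt B n a) = Poly_Mapping.lookup p a"
proof -
  have "coeff (kron B n p) (wt B n a) =
      (\<Sum>b\<in>Poly_Mapping.keys p. if b = a then Poly_Mapping.lookup p b else 0)"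
    unfolding kron_def linear_extension_def coeff_sum
  proof (rule sum.cong[OF refl])
    fix b assume "b \<in> Poly_Mapping.keys p"
    then have "wt B n b = wt B n a \<longleftrightarrow> b = a"
      using inj_on_eq_iff[OF inj_on_wt[OF assms(2)]] assms(1,3) by (auto simp: Sym_iff)
    then show "coeff (Polynomial.monom (Poly_Mapping.lookup p b) (wt B n b)) (wt B n a) =
        (if b = a then Poly_Mapping.lookup p b else 0)"
      by simp
  qed
  then show ?thesis by (simp add: in_keys_iff)
qed

lemma coeff_kron_eq_0:
  assumes "p \<in> Sym n m" and "e \<notin> wt B n ` Mon n m"
  shows "coeff (kron B n p) e = 0"
  unfolding kron_def linear_extension_def coeff_sum
  using assms by (intro sum.neutral) (auto simp: Sym_iff)

lemma kron_inject:
  assumes "p \<in> Sym n m" "q \<in> Sym n m" "m < B" "kron B n p = kron B n q"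
  shows "p = q"
proof (rule poly_mapping_eqI)
  fix a
  show "Poly_Mapping.lookup p a = Poly_Mapping.lookup q a"
  proof (cases "a \<in> Mon n m")
    case True
    then show ?thesis using coeff_kron assms by metis
  next
    case False
    then have "a \<notin> Poly_Mapping.keys p" "a \<notin> Poly_Mapping.keys q"
      using assms by (auto simp: Sym_iff)
    then show ?thesis by (simp add: in_keys_iff)
  qed
qed

text \<open>Together with \<open>coeff_kron_eq_0\<close> this describes the image by the vanishing
  of certain coefficients, which makes being split a closed condition on labellings.\<close>

lemma kron_surj:
  assumes "m < B" and "\<And>e. e \<notin> wt B n ` Mon n m \<Longrightarrow> coeff r e = 0"
  shows "\<exists>p\<in>Sym n m. kron B n p = r"
proof
  let ?m = "inv_into (Mon n m) (wt B n)"
  let ?p = "\<Sum>e\<le>degree r. if e \<in> wt B n ` Mon n m then Poly_Mapping.single (?m e) (coeff r e) else 0"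
  show "?p \<in> Sym n m"
    by (intro Sym_sum) (auto intro!: Sym_single inv_into_into)
  have "kron B n ?p = (\<Sum>e\<le>degree r. Polynomial.monom (coeff r e) e)"
    unfolding kron_sum
    using assms(2) by (intro sum.cong) (auto simp: kron_single f_inv_into_f)
  then show "kron B n ?p = r"
    by (simp add: poly_as_sum_of_monoms)
qed

lemma degree_kron_le:
  assumes "p \<in> Sym n m" and "B > 0"
  shows "degree (kron B n p) \<le> m * B ^ (n - 1)"
proof (rule degree_le, intro allI impI coeff_kron_eq_0[OF assms(1)])
  fix e assume "e > m * B ^ (n - 1)"
  then show "e \<notin> wt B n ` Mon n m"
    using wt_le[OF _ assms(2)] by fastforce
qed

section \<open>Factorizations into two monic forms\<close>

definition split_poly :: "nat set \<Rightarrow> (nat \<Rightarrow> complex) \<Rightarrow> complex poly" where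
  "split_poly T z = (\<Prod>l\<in>T. [:- z l, 1:])"

lemma split_poly_insert:
  "finite T \<Longrightarrow> l \<notin> T \<Longrightarrow> split_poly (insert l T) z = [:- z l, 1:] * split_poly T z"
  by (simp add: split_poly_def)

lemma split_poly_complement:
  "finite A \<Longrightarrow> T \<subseteq> A \<Longrightarrow> split_poly A z = split_poly T z * split_poly (A - T) z"
  unfolding split_poly_def using prod.subset_diff[of T A] by (simp add: mult.commute)

lemma poly_split_poly_eq_0_iff:
  "finite T \<Longrightarrow> poly (split_poly T z) a = 0 \<longleftrightarrow> (\<exists>l\<in>T. a = z l)"
  by (auto simp: split_poly_def poly_prod)

lemma lead_coeff_split_poly [simp]: "lead_coeff (split_poly T z) = 1"
  by (simp add: split_poly_def lead_coeff_prod)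

lemma split_poly_neq_0 [simp]: "split_poly T z \<noteq> 0"
  using lead_coeff_split_poly[of T z] by (metis leading_coeff_0_iff zero_neq_one)

lemma split_poly_eq_iff:
  assumes "inj_on z A" "S \<subseteq> A" "T \<subseteq> A" "finite A"
  shows "split_poly S z = split_poly T z \<longleftrightarrow> S = T"
proof
  assume eq: "split_poly S z = split_poly T z"
  have "finite S" "finite T" using assms finite_subset by auto
  then have "a \<in> z ` S \<longleftrightarrow> a \<in> z ` T" for a
    using poly_split_poly_eq_0_iff[of S z a] poly_split_poly_eq_0_iff[of T z a] eq by auto
  then have "z ` S = z ` T" by blast
  then show "S = T" using inj_on_image_eq_iff[OF assms(1-3)] by simp
qed simp

text \<open>Each linear factor divides \<open>p\<close> or \<open>q\<close> and is moved there, one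
  label at a time. Labels are distributed rather than roots, so repeated roots are allowed; monicity
  of \<open>p\<close> fixes the constants.\<close>

lemma split_poly_factors:
  assumes "finite A" and "p * q = split_poly A z" and "lead_coeff p = 1"
  shows "\<exists>T\<subseteq>A. p = split_poly T z \<and> q = split_poly (A - T) z"
  using assms
proof (induction A arbitrary: p q rule: finite_induct)
  case empty
  then have pq: "p * q = 1" by (simp add: split_poly_def)
  then have "degree p = 0" by (metis degree_mult_eq_0 degree_1 mult_zero_left mult_zero_right zero_neq_one)
  then have "p = 1" using empty.prems(2) by (auto elim!: degree_eq_zeroE)
  then show ?case using pq by (simp add: split_poly_def)
next
  case (insert l A)
  have eq: "p * q = [:- z l, 1:] * split_poly A z"
    using insert by (simp add: split_poly_insert)
  have "poly p (z l) * poly q (z l) = 0"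
    using arg_cong[OF eq, of "\<lambda>r. poly r (z l)"] by simp
  then consider "poly p (z l) = 0" | "poly q (z l) = 0" by auto
  then show ?case
  proof cases
    case 1
    then obtain p' where p': "p = [:- z l, 1:] * p'"
      unfolding poly_eq_0_iff_dvd by (elim dvdE)
    then have "p' * q = split_poly A z"
      using eq by (simp only: mult.assoc mult_cancel_left) simp
    moreover have "lead_coeff p' = 1"
      using insert.prems(2) unfolding p' lead_coeff_mult by simp
    ultimately obtain T where T: "T \<subseteq> A" "p' = split_poly T z" "q = split_poly (A - T) z"
      using insert.IH by blast
    have "p = split_poly (insert l T) z"
      using T(1) insert.hyps finite_subset[of T A] by (subst split_poly_insert) (auto simp: p' T(2))
    moreover have "insert l A - insert l T = A - T"
      using insert.hyps by auto
    ultimately show ?thesis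
      using T by (intro exI[of _ "insert l T"]) auto
  next
    case 2
    then obtain q' where q': "q = [:- z l, 1:] * q'"
      unfolding poly_eq_0_iff_dvd by (elim dvdE)
    then have "p * q' = split_poly A z"
      using eq by (simp only: mult.left_commute[of p] mult_cancel_left) simp
    then obtain T where T: "T \<subseteq> A" "p = split_poly T z" "q' = split_poly (A - T) z"
      using insert.IH insert.prems(2) by blast
    have lT: "l \<notin> T" using T(1) insert.hyps by auto
    have "q = split_poly (insert l (A - T)) z"
      using insert.hyps by (subst split_poly_insert) (auto simp: q' T(3))
    moreover have "insert l A - T = insert l (A - T)"
      using lT by auto
    ultimately show ?thesis
      using T by (intro exI[of _ T]) auto
  qed
qed

lemma split_poly_ex:
  fixes p :: "complex poly"
  assumes "lead_coeff p = 1" and "degree p = N"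
  shows "\<exists>z. p = split_poly {..<N} z"
proof -
  have "p \<noteq> 0" using assms(1) by auto
  then obtain as where "size (mset as) = degree p"
      "p = Polynomial.smult (lead_coeff p) (\<Prod>a\<in>#mset as. [:- a, 1:])"
    using alg_closed_imp_factorization[of p] by (metis ex_mset)
  then have as: "p = (\<Prod>a\<leftarrow>as. [:- a, 1:])" "length as = degree p"
    using assms(1) by (simp_all add: prod_mset_prod_list flip: mset_map)
  have "(\<Prod>a\<leftarrow>as. [:- a, 1:]) = (\<Prod>l<length as. [:- (as ! l), 1:])"
    by (simp add: prod.list_conv_set_nth atLeast0LessThan)
  then have "p = split_poly {..<N} (\<lambda>l. as ! l)"
    using as assms by (simp add: split_poly_def)
  then show ?thesis by blast
qed

lemma polynomial_functions_coeff_split_poly: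
  assumes "T \<subseteq> {..<M}"
  shows "(\<lambda>x. coeff (split_poly T (snd x)) e) \<in> polynomial_functions (adjoin_coords C M)"
proof -
  have "finite T" using assms finite_subset by blast
  then show ?thesis
    using assms
  proof (induction T arbitrary: e rule: finite_induct)
    case empty
    show ?case by (simp add: split_poly_def polynomial_functions.const)
  next
    case (insert l T)
    have lin: "(\<lambda>x. coeff [:- snd x l, 1:] i) \<in> polynomial_functions (adjoin_coords C M)" for i
    proof (cases i)
      case 0
      then show ?thesis
        using insert.prems by (auto intro!: polynomial_functions_uminus polynomial_functions_adjoin_snd)
    next
      case (Suc j)
      then show ?thesis by (simp add: polynomial_functions.const)
    qed
    show ?case
      unfolding split_poly_insert[OF insert.hyps(1,2)] coeff_mult
      using insert by (intro polynomial_functions_sum polynomial_functions.mult lin) auto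
  qed
qed

text \<open>
  Forms are monic with respect to \<open>x\<^sub>n\<^sub>-\<^sub>1\<close>, the variable of largest weight.
\<close>

abbreviation lead_monom :: "nat \<Rightarrow> nat \<Rightarrow> (nat \<Rightarrow>\<^sub>0 nat)" where
  "lead_monom n m \<equiv> Poly_Mapping.single (n - 1) m"

definition monic_forms :: "nat \<Rightarrow> nat \<Rightarrow> cpoly set" where
  "monic_forms n m = {p \<in> Sym n m. Poly_Mapping.lookup p (lead_monom n m) = 1}"

lemma Mon_single:
  assumes "i \<le> n"
  shows "Poly_Mapping.single i m \<in> Mon n m"
  using assms by (simp add: Mon_def lookup_single when_def)

lemma wt_lead_monom: "n > 0 \<Longrightarrow> wt B n (lead_monom n m) = m * B ^ (n - 1)"
  by (simp add: wt_single)

lemma coeff_kron_lead: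
  assumes "p \<in> Sym n m" "m < B" "n > 0"
  shows "coeff (kron B n p) (m * B ^ (n - 1)) = Poly_Mapping.lookup p (lead_monom n m)"
  using coeff_kron[OF assms(1,2), of "lead_monom n m"] Mon_single[of "n - 1" n m]
  unfolding wt_lead_monom[OF assms(3)] by simp

text \<open>The power of the variable of largest weight attains the maximal weight
  \<open>m * B ^ (n - 1)\<close>, so its coefficient is the top coefficient of the Kronecker
  image.\<close>

lemma monic_forms_iff:
  assumes "m < B" "n > 0"
  shows "p \<in> monic_forms n m \<longleftrightarrow>
    p \<in> Sym n m \<and> degree (kron B n p) = m * B ^ (n - 1) \<and> lead_coeff (kron B n p) = 1"
proof (cases "p \<in> Sym n m")
  case True
  have le: "degree (kron B n p) \<le> m * B ^ (n - 1)"
    using degree_kron_le[OF True] assms(1) by simp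
  have "degree (kron B n p) = m * B ^ (n - 1)" if "coeff (kron B n p) (m * B ^ (n - 1)) = 1"
    using le_degree[of "kron B n p" "m * B ^ (n - 1)"] that le by simp
  then show ?thesis
    using True coeff_kron_lead[OF True assms] unfolding monic_forms_def by auto
qed (simp add: monic_forms_def)

text \<open>
  On monic forms this is \<open>kron\<close>; forcing the leading coefficient to be \<open>1\<close> for every \<open>f\<close> makes it a family
  of monic polynomials over the whole space of polynomials.
\<close>

definition monic_kron :: "nat \<Rightarrow> nat \<Rightarrow> nat \<Rightarrow> cpoly \<Rightarrow> complex poly" where
  "monic_kron B n m f = Polynomial.monom 1 (m * B ^ (n - 1)) + (\<Sum>e<m * B ^ (n - 1). Polynomial.monom
    (if e \<in> wt B n ` Mon n m then Poly_Mapping.lookup f (inv_into (Mon n m) (wt B n) e) else 0) e)"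

lemma coeff_monic_kron:
  "coeff (monic_kron B n m f) e = (if e = m * B ^ (n - 1) then 1
    else if e < m * B ^ (n - 1) \<and> e \<in> wt B n ` Mon n m
    then Poly_Mapping.lookup f (inv_into (Mon n m) (wt B n) e) else 0)"
  unfolding monic_kron_def coeff_add coeff_sum coeff_monom
  by (subst sum.delta) auto

lemma degree_monic_kron: "degree (monic_kron B n m f) = m * B ^ (n - 1)"
proof (rule antisym)
  show "degree (monic_kron B n m f) \<le> m * B ^ (n - 1)"
    by (rule degree_le) (auto simp: coeff_monic_kron)
  show "m * B ^ (n - 1) \<le> degree (monic_kron B n m f)"
    by (rule le_degree) (simp add: coeff_monic_kron)
qed

lemma lead_coeff_monic_kron: "lead_coeff (monic_kron B n m f) = 1"
  by (simp add: degree_monic_kron coeff_monic_kron)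

lemma polynomial_functions_monic_kron:
  "(\<lambda>f. coeff (monic_kron B n m f) e) \<in> polynomial_functions Defs.coeffs"
  unfolding coeff_monic_kron
  by (intro polynomial_functions_if polynomial_functions.const polynomial_functions.coord)
    (auto simp: Defs.coeffs_def)

lemma monic_kron_eq:
  assumes "f \<in> monic_forms n m" "m < B" "n > 0"
  shows "monic_kron B n m f = kron B n f"
proof (rule poly_eqI)
  fix e
  have f: "f \<in> Sym n m" using assms(1) by (simp add: monic_forms_def)
  consider "e = m * B ^ (n - 1)" | "e < m * B ^ (n - 1)" "e \<in> wt B n ` Mon n m"
    | "e \<notin> wt B n ` Mon n m" "e \<noteq> m * B ^ (n - 1)" | "e > m * B ^ (n - 1)" by linarith
  then show "coeff (monic_kron B n m f) e = coeff (kron B n f) e"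
  proof cases
    case 1
    then show ?thesis
      using coeff_kron_lead[OF f assms(2,3)] assms(1) by (simp add: coeff_monic_kron monic_forms_def)
  next
    case 2
    then show ?thesis
      using coeff_kron[OF f assms(2) inv_into_into[OF 2(2)]]
      by (simp add: coeff_monic_kron f_inv_into_f)
  next
    case 3
    then show ?thesis
      using coeff_kron_eq_0[OF f 3(1)] by (simp add: coeff_monic_kron)
  next
    case 4
    then show ?thesis
      using degree_kron_le[OF f, of B] assms(2) by (simp add: coeff_monic_kron coeff_eq_0)
  qed
qed

section \<open>Factorizations as subsets of labelled roots\<close>

locale forms =
  fixes n d :: nat
  assumes n: "n \<ge> 2" and d: "d \<ge> 1"
begin

text \<open>Exponents in a product of two forms of degree \<open>d\<close> are at most
  \<open>2 * d\<close>, so this base serves both degrees. \<open>N\<close> and \<open>M\<close> are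
  the degrees of the Kronecker images of monic forms of degrees \<open>d\<close> and
  \<open>2 * d\<close>.\<close>

definition B :: nat where "B = 2 * d + 1"
definition N :: nat where "N = d * B ^ (n - 1)"
definition M :: nat where "M = 2 * N"

lemma d_less_B: "d < B" "2 * d < B" "n > 0"
  using n by (simp_all add: B_def)

lemma N_ge_2: "N \<ge> 2"
proof -
  have "B ^ 1 \<le> B ^ (n - 1)" using n by (intro power_increasing) (auto simp: B_def)
  also have "\<dots> \<le> N" using d by (simp add: N_def)
  finally show ?thesis using d by (simp add: B_def)
qed

lemma M_eq: "2 * d * B ^ (n - 1) = M"
  by (simp add: M_def N_def)

text \<open>
  A labelling \<open>z\<close> of the \<open>M\<close> roots of the Kronecker image of a form is split at \<open>T\<close> if the partial products
  over \<open>T\<close> and its complement have only exponents that occur in Kronecker images of forms of degree \<open>d\<close>.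
\<close>

definition split_at :: "nat set \<Rightarrow> (nat \<Rightarrow> complex) \<Rightarrow> bool" where
  "split_at T z \<longleftrightarrow> (\<forall>e. e \<notin> wt B n ` Mon n d \<longrightarrow>
    coeff (split_poly T z) e = 0 \<and> coeff (split_poly ({..<M} - T) z) e = 0)"

text \<open>Reserving the first \<open>N\<close> labels for one factor costs nothing, since the
  roots may be labelled in any order.\<close>

definition labelled_products :: "(cpoly \<times> (nat \<Rightarrow> complex)) set" where
  "labelled_products = {(f, z). monic_kron B n (2 * d) f = split_poly {..<M} z \<and> split_at {..<N} z}"

text \<open>The two exempted subsets describe the given factorization in its two orders.\<close>

definition labelled_bad :: "(cpoly \<times> (nat \<Rightarrow> complex)) set" where
  "labelled_bad = labelled_products \<inter> {(f, z). (\<exists>i<M. \<exists>j<M. i \<noteq> j \<and> z i = z j) \<or>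
    (\<exists>T\<subseteq>{..<M}. T \<noteq> {..<N} \<and> T \<noteq> {..<M} - {..<N} \<and> split_at T z)}"

lemma closedin_split_at:
  assumes "T \<subseteq> {..<M}"
  shows "closedin (zariski (adjoin_coords Defs.coeffs M) UNIV) {x. split_at T (snd x)}"
proof -
  let ?c = "\<lambda>T e x. coeff (split_poly T (snd x)) e"
  show ?thesis
    unfolding closedin_zariski
    by (rule exI[of _ "\<Union>e\<in>- (wt B n ` Mon n d). {?c T e, ?c ({..<M} - T) e}"])
      (use assms in \<open>auto simp: split_at_def intro!: polynomial_functions_coeff_split_poly\<close>)
qed

lemma closedin_labelled_products:
  "closedin (zariski (adjoin_coords Defs.coeffs M) UNIV) labelled_products"
proof -
  let ?Z = "{x. monic_kron B n (2 * d) (fst x) = split_poly {..<M} (snd x)}"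
  have "closedin (zariski (adjoin_coords Defs.coeffs M) UNIV) ?Z"
    unfolding closedin_zariski
    by (rule exI[of _ "range (\<lambda>e (x :: cpoly \<times> (nat \<Rightarrow> complex)).
        coeff (monic_kron B n (2 * d) (fst x)) e - coeff (split_poly {..<M} (snd x)) e)"])
      (auto simp: poly_eq_iff intro!: polynomial_functions_diff polynomial_functions_coeff_split_poly
        polynomial_functions_adjoin_fst polynomial_functions_monic_kron)
  moreover have "closedin (zariski (adjoin_coords Defs.coeffs M) UNIV)
      {x :: cpoly \<times> (nat \<Rightarrow> complex). split_at {..<N} (snd x)}"
    by (rule closedin_split_at) (auto simp: M_def)
  ultimately have "closedin (zariski (adjoin_coords Defs.coeffs M) UNIV)
      (?Z \<inter> {x. split_at {..<N} (snd x)})"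
    by (rule closedin_Int)
  moreover have "labelled_products = ?Z \<inter> {x. split_at {..<N} (snd x)}"
    unfolding labelled_products_def by auto
  ultimately show ?thesis by simp
qed

lemma closedin_labelled_bad:
  "closedin (zariski (adjoin_coords Defs.coeffs M) UNIV) labelled_bad"
proof -
  let ?X = "zariski (adjoin_coords Defs.coeffs M) UNIV"
  let ?I = "{(i, j). i < M \<and> j < M \<and> i \<noteq> j}"
  let ?T = "Pow {..<M} - {{..<N}, {..<M} - {..<N}}"
  let ?K = "(\<lambda>(i, j). {x :: cpoly \<times> (nat \<Rightarrow> complex). snd x i = snd x j}) ` ?I \<union>
    (\<lambda>T. {x. split_at T (snd x)}) ` ?T"
  have "?I \<subseteq> {..<M} \<times> {..<M}" by auto
  then have "finite ?I" by (rule finite_subset) simp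
  then have "finite ?K" by simp
  moreover have "closedin ?X {x. snd x i = snd x j}" if "i < M" "j < M" for i j
    using closedin_zariski_zeros[of "\<lambda>x. snd x i - snd x j" "adjoin_coords Defs.coeffs M" UNIV] that
    by (simp add: polynomial_functions_diff polynomial_functions_adjoin_snd)
  ultimately have "closedin ?X (\<Union>?K)"
    by (intro closedin_Union) (auto intro: closedin_split_at)
  then have "closedin ?X (labelled_products \<inter> \<Union>?K)"
    using closedin_labelled_products by (intro closedin_Int)
  moreover have "labelled_bad = labelled_products \<inter> \<Union>?K"
  proof (rule Set.set_eqI)
    fix x
    have "x \<in> \<Union>?K \<longleftrightarrow> (\<exists>i<M. \<exists>j<M. i \<noteq> j \<and> snd x i = snd x j) \<or>
        (\<exists>T\<subseteq>{..<M}. T \<noteq> {..<N} \<and> T \<noteq> {..<M} - {..<N} \<and> split_at T (snd x))"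
      unfolding Union_Un_distrib Un_iff by (rule arg_cong2[of _ _ _ _ "(\<or>)"]) blast+
    then show "x \<in> labelled_bad \<longleftrightarrow> x \<in> labelled_products \<inter> \<Union>?K"
      unfolding labelled_bad_def Int_iff mem_Collect_eq split_beta by (simp only:)
  qed
  ultimately show ?thesis by simp
qed

lemma closedin_products:
  assumes "closedin (zariski (adjoin_coords Defs.coeffs M) UNIV) Z" and "Z \<subseteq> labelled_products"
  shows "closedin (zariski Defs.coeffs UNIV) (fst ` Z)"
proof (rule closedin_image_fst_roots[where P = "monic_kron B n (2 * d)" and k = M])
  show "(\<lambda>w. coeff (monic_kron B n (2 * d) w) j) \<in> polynomial_functions Defs.coeffs" for j
    by (rule polynomial_functions_monic_kron)
  show "degree (monic_kron B n (2 * d) w) = 2 * d * B ^ (n - 1)" for w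
    by (rule degree_monic_kron)
  show "lead_coeff (monic_kron B n (2 * d) w) = 1" for w
    by (rule lead_coeff_monic_kron)
  show "closedin (zariski (adjoin_coords Defs.coeffs M) UNIV) Z" by fact
  show "poly (monic_kron B n (2 * d) w) (z i) = 0" if "(w, z) \<in> Z" "i < M" for w z i
  proof -
    have "monic_kron B n (2 * d) w = split_poly {..<M} z"
      using that assms(2) unfolding labelled_products_def by auto
    then show ?thesis
      using that by (auto simp: poly_split_poly_eq_0_iff)
  qed
qed

text \<open>The size of \<open>T\<close> is not prescribed: images of forms of degree
  \<open>d\<close> have degree at most \<open>N\<close>, and here the two degrees add up to
  \<open>2 * N\<close>, so both equal \<open>N\<close>.\<close>

lemma split_at_forms:
  assumes "f \<in> monic_forms n (2 * d)" "monic_kron B n (2 * d) f = split_poly {..<M} z"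
    and T: "T \<subseteq> {..<M}" "split_at T z"
  shows "\<exists>p\<in>monic_forms n d. \<exists>q\<in>monic_forms n d. p * q = f \<and>
    kron B n p = split_poly T z \<and> kron B n q = split_poly ({..<M} - T) z"
proof -
  have f: "f \<in> Sym n (2 * d)" using assms(1) by (simp add: monic_forms_def)
  obtain p where p: "p \<in> Sym n d" "kron B n p = split_poly T z"
    using kron_surj[OF d_less_B(1), of n "split_poly T z"] T(2) unfolding split_at_def by blast
  obtain q where q: "q \<in> Sym n d" "kron B n q = split_poly ({..<M} - T) z"
    using kron_surj[OF d_less_B(1), of n "split_poly ({..<M} - T) z"] T(2)
    unfolding split_at_def by blast
  have "split_poly {..<M} z = split_poly T z * split_poly ({..<M} - T) z"
    using T(1) by (intro split_poly_complement) auto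
  then have eq: "kron B n (p * q) = kron B n f"
    using assms(2) monic_kron_eq[OF assms(1) d_less_B(2,3)] by (simp add: kron_mult p(2) q(2))
  have "p * q \<in> Sym n (2 * d)"
    using Sym_mult[OF p(1) q(1)] by (simp add: mult_2)
  then have pq: "p * q = f"
    using kron_inject[OF _ f d_less_B(2) eq] by simp
  have "degree (kron B n f) = M"
    using monic_kron_eq[OF assms(1) d_less_B(2,3)] degree_monic_kron[of B n "2 * d" f] M_eq by simp
  then have "degree (kron B n p) + degree (kron B n q) = 2 * N"
    unfolding pq[symmetric] kron_mult M_def[symmetric] p(2) q(2)
    by (simp add: degree_mult_eq)
  moreover have "degree (kron B n p) \<le> N" "degree (kron B n q) \<le> N"
    using degree_kron_le[OF p(1), of B] degree_kron_le[OF q(1), of B] d_less_B(1) by (auto simp: N_def)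
  ultimately have "degree (kron B n p) = N" "degree (kron B n q) = N" by auto
  then have "p \<in> monic_forms n d" "q \<in> monic_forms n d"
    unfolding monic_forms_iff[OF d_less_B(1,3)] p(2) q(2) lead_coeff_split_poly
    using p(1) q(1) by (simp_all only: N_def simp_thms)
  then show ?thesis using pq p(2) q(2) by blast
qed

lemma monic_forms_mult:
  assumes "p \<in> monic_forms n d" "q \<in> monic_forms n d"
  shows "p * q \<in> monic_forms n (2 * d)"
proof -
  have "p * q \<in> Sym n (2 * d)"
    using assms Sym_mult[of p n d q d] by (simp add: monic_forms_def mult_2)
  moreover have "degree (kron B n p * kron B n q) = 2 * d * B ^ (n - 1)"
    using assms unfolding monic_forms_iff[OF d_less_B(1,3)] by (subst degree_mult_eq) auto
  moreover have "lead_coeff (kron B n p) = 1" "lead_coeff (kron B n q) = 1"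
    using assms unfolding monic_forms_iff[OF d_less_B(1,3)] by blast+
  then have "lead_coeff (kron B n p * kron B n q) = 1"
    by (simp only: lead_coeff_mult mult_1)
  ultimately show ?thesis
    unfolding monic_forms_iff[OF d_less_B(2,3)] kron_mult by blast
qed

lemma split_at_iff_forms:
  assumes "T \<subseteq> {..<M}" "p \<in> Sym n d" "q \<in> Sym n d"
    "kron B n p = split_poly T z" "kron B n q = split_poly ({..<M} - T) z"
  shows "split_at T z"
  unfolding split_at_def using assms coeff_kron_eq_0 by metis

lemma products_mem:
  assumes "p \<in> monic_forms n d" "q \<in> monic_forms n d"
  shows "p * q \<in> fst ` labelled_products"
proof -
  have p: "lead_coeff (kron B n p) = 1" "degree (kron B n p) = N"
    and q: "lead_coeff (kron B n q) = 1" "degree (kron B n q) = N"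
    using assms unfolding monic_forms_iff[OF d_less_B(1,3)] by (auto simp: N_def)
  obtain a where a: "kron B n p = split_poly {..<N} a" using split_poly_ex[OF p] by blast
  obtain b where b: "kron B n q = split_poly {..<N} b" using split_poly_ex[OF q] by blast
  \<comment> \<open>The roots of the second factor are shifted to the labels from \<open>N\<close>
    to \<open>M - 1\<close>.\<close>
  define z where "z l = (if l < N then a l else b (l - N))" for l
  have za: "split_poly {..<N} z = kron B n p"
    unfolding a split_poly_def by (intro prod.cong) (auto simp: z_def)
  have zb: "split_poly ({..<M} - {..<N}) z = kron B n q"
    unfolding b split_poly_def
    by (rule prod.reindex_bij_witness[of _ "\<lambda>l. l + N" "\<lambda>l. l - N"]) (auto simp: z_def M_def)
  have "split_poly {..<M} z = split_poly {..<N} z * split_poly ({..<M} - {..<N}) z"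
    by (rule split_poly_complement) (auto simp: M_def)
  then have "monic_kron B n (2 * d) (p * q) = split_poly {..<M} z"
    unfolding za zb monic_kron_eq[OF monic_forms_mult[OF assms] d_less_B(2,3)] kron_mult
    by (rule sym)
  moreover have "split_at {..<N} z"
    by (rule split_at_iff_forms[of _ p q]) (use assms za zb in \<open>auto simp: monic_forms_def M_def\<close>)
  ultimately have "(p * q, z) \<in> labelled_products"
    unfolding labelled_products_def by simp
  then show ?thesis by force
qed

definition unique_factors :: "cpoly \<Rightarrow> cpoly \<Rightarrow> bool" where
  "unique_factors p q \<longleftrightarrow> p \<in> monic_forms n d \<and> q \<in> monic_forms n d \<and>
    (\<forall>p'\<in>monic_forms n d. \<forall>q'\<in>monic_forms n d. p' * q' = p * q \<longrightarrow>
      p' = p \<and> q' = q \<or> p' = q \<and> q' = p)"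

text \<open>Any monic factorization of \<open>f\<close> distributes the labels over some
  \<open>T\<close> at which \<open>z\<close> is split, and only the two exempted subsets remain.
  Distinct roots give distinct partial products, hence \<open>p \<noteq> q\<close>.\<close>

lemma unique_factors_if_not_bad:
  assumes f: "f \<in> monic_forms n (2 * d)" "f \<in> fst ` labelled_products" "f \<notin> fst ` labelled_bad"
  shows "\<exists>p q. unique_factors p q \<and> p \<noteq> q \<and> p * q = f"
proof -
  obtain z where z: "monic_kron B n (2 * d) f = split_poly {..<M} z" "split_at {..<N} z"
    using f(2) unfolding labelled_products_def by auto
  have "(f, z) \<notin> labelled_bad" using f(3) by force
  then have good: "\<And>i j. i < M \<Longrightarrow> j < M \<Longrightarrow> z i = z j \<Longrightarrow> i = j"
    "\<And>T. T \<subseteq> {..<M} \<Longrightarrow> split_at T z \<Longrightarrow> T = {..<N} \<or> T = {..<M} - {..<N}"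
    using z unfolding labelled_bad_def labelled_products_def by blast+
  obtain p q where p: "p \<in> monic_forms n d" "kron B n p = split_poly {..<N} z"
    and q: "q \<in> monic_forms n d" "kron B n q = split_poly ({..<M} - {..<N}) z" and pq: "p * q = f"
    using split_at_forms[OF f(1) z(1) _ z(2)] by (auto simp: M_def)
  have inj: "inj_on z {..<M}" using good(1) by (auto intro: inj_onI)
  have "0 \<in> {..<N}" using N_ge_2 by simp
  then have "{..<N} \<noteq> {..<M} - {..<N}" by blast
  then have "split_poly {..<N} z \<noteq> split_poly ({..<M} - {..<N}) z"
    by (subst split_poly_eq_iff[OF inj]) (auto simp: M_def)
  then have "p \<noteq> q" using p(2) q(2) by auto
  moreover have "p' = p \<and> q' = q \<or> p' = q \<and> q' = p"
    if p': "p' \<in> monic_forms n d" and q': "q' \<in> monic_forms n d" and eq: "p' * q' = p * q" for p' q'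
  proof -
    have "kron B n p' * kron B n q' = split_poly {..<M} z"
      using z(1) monic_kron_eq[OF f(1) d_less_B(2,3)] eq pq by (simp add: kron_mult[symmetric])
    moreover have "lead_coeff (kron B n p') = 1"
      using p' unfolding monic_forms_iff[OF d_less_B(1,3)] by blast
    ultimately obtain T where T: "T \<subseteq> {..<M}" "kron B n p' = split_poly T z"
        "kron B n q' = split_poly ({..<M} - T) z"
      using split_poly_factors[of "{..<M}"] by blast
    then have "split_at T z"
      using p' q' by (intro split_at_iff_forms[of _ p' q']) (auto simp: monic_forms_def)
    then consider "T = {..<N}" | "T = {..<M} - {..<N}"
      using good(2)[OF T(1)] by blast
    then have "kron B n p' = kron B n p \<and> kron B n q' = kron B n q \<or>
        kron B n p' = kron B n q \<and> kron B n q' = kron B n p"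
    proof cases
      case 2
      then have "{..<M} - T = {..<N}" by (auto simp: M_def)
      then show ?thesis using T 2 p(2) q(2) by simp
    qed (use T p(2) q(2) in simp)
    then show ?thesis
      using kron_inject[OF _ _ d_less_B(1)] p(1) q(1) p' q' unfolding monic_forms_def by blast
  qed
  ultimately show ?thesis
    using p(1) q(1) pq unfolding unique_factors_def by blast
qed

text \<open>Two equal labels would make a double root, at which the derivative vanishes. A split
  \<open>T\<close> yields a factorization, so by uniqueness its partial product is one of the two
  known ones; injectivity of the labelling then identifies \<open>T\<close> itself.\<close>

lemma not_bad_if_unique_factors:
  assumes "unique_factors p q"
    and sqfree: "\<And>a. poly (kron B n (p * q)) a = 0 \<Longrightarrow> poly (pderiv (kron B n (p * q))) a \<noteq> 0"
  shows "p * q \<notin> fst ` labelled_bad"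
proof
  assume "p * q \<in> fst ` labelled_bad"
  then obtain z where bad: "(p * q, z) \<in> labelled_bad" by auto
  then have z: "monic_kron B n (2 * d) (p * q) = split_poly {..<M} z" "split_at {..<N} z"
    unfolding labelled_bad_def labelled_products_def by auto
  have f: "p * q \<in> monic_forms n (2 * d)"
    using assms(1) monic_forms_mult unfolding unique_factors_def by blast
  have kr: "kron B n (p * q) = split_poly {..<M} z"
    using z(1) monic_kron_eq[OF f d_less_B(2,3)] by simp
  have inj: "inj_on z {..<M}"
  proof (rule inj_onI, rule ccontr)
    fix i j assume ij: "i \<in> {..<M}" "j \<in> {..<M}" "z i = z j" "i \<noteq> j"
    then have "{..<M} = insert i (insert j ({..<M} - {i, j}))" by auto
    also have "split_poly \<dots> z = [:- z i, 1:] * ([:- z j, 1:] * split_poly ({..<M} - {i, j}) z)"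
      using ij by (simp add: split_poly_insert)
    finally have "kron B n (p * q) = [:- z i, 1:] * ([:- z i, 1:] * split_poly ({..<M} - {i, j}) z)"
      using kr ij by simp
    moreover have "poly [:- z i, 1:] (z i) = 0" by simp
    ultimately show False
      using sqfree[of "z i"] by (simp only: pderiv_mult poly_add poly_mult) simp
  qed
  have factors: "split_poly T z = kron B n p \<or> split_poly T z = kron B n q"
    if "T \<subseteq> {..<M}" "split_at T z" for T
    using split_at_forms[OF f z(1) that] assms(1) unfolding unique_factors_def by metis
  have "split_poly {..<N} z * split_poly ({..<M} - {..<N}) z = kron B n p * kron B n q"
    unfolding kron_mult[symmetric] kr
    by (rule split_poly_complement[symmetric]) (auto simp: M_def)
  moreover have "kron B n p \<noteq> 0" "kron B n q \<noteq> 0"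
    using assms(1) unfolding unique_factors_def monic_forms_iff[OF d_less_B(1,3)] by auto
  ultimately have eqs: "split_poly {..<N} z = kron B n p \<and> split_poly ({..<M} - {..<N}) z = kron B n q \<or>
      split_poly {..<N} z = kron B n q \<and> split_poly ({..<M} - {..<N}) z = kron B n p"
    using factors[OF _ z(2)] by (auto simp: M_def)
  obtain T where T: "T \<subseteq> {..<M}" "T \<noteq> {..<N}" "T \<noteq> {..<M} - {..<N}" "split_at T z"
    using bad inj unfolding labelled_bad_def inj_on_def by auto
  have "split_poly T z = split_poly {..<N} z \<or> split_poly T z = split_poly ({..<M} - {..<N}) z"
    using factors[OF T(1,4)] eqs by auto
  moreover have "{..<N} \<subseteq> {..<M}" "{..<M} - {..<N} \<subseteq> {..<M}"
    by (auto simp: M_def)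
  ultimately show False
    using T(2,3) split_poly_eq_iff[OF inj T(1)] by blast
qed

end

section \<open>A product with a unique factorization\<close>

text \<open>A monic linear polynomial over an integral domain is prime by the factor theorem, so
  each of the two goes entirely to \<open>u\<close> or to \<open>v\<close>; \<open>w\<close> and
  \<open>w'\<close> are the remaining units.\<close>

lemma split_linear_factors:
  fixes u v :: "'a :: idom poly"
  assumes "u * v = [:- a, 1:] * [:- b, 1:]" and "a \<noteq> b"
  obtains w w' where "w * w' = 1"
    "u = [:- a, 1:] * [:- b, 1:] * w \<and> v = w' \<or> u = [:- a, 1:] * w \<and> v = [:- b, 1:] * w' \<or>
     u = [:- b, 1:] * w \<and> v = [:- a, 1:] * w' \<or> u = w \<and> v = [:- a, 1:] * [:- b, 1:] * w'"
proof -
  have key: "\<exists>w w'. w * w' = 1 \<and> (u = [:- a, 1:] * [:- b, 1:] * w \<and> v = w' \<or>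
      u = [:- a, 1:] * w \<and> v = [:- b, 1:] * w')"
    if eq: "u * v = [:- a, 1:] * [:- b, 1:]" and u: "poly u a = 0" for u v :: "'a poly"
  proof -
    obtain u' where u': "u = [:- a, 1:] * u'"
      using u unfolding poly_eq_0_iff_dvd by (elim dvdE)
    have 1: "u' * v = [:- b, 1:]"
      using eq unfolding u' mult.assoc by (subst (asm) mult_cancel_left) simp
    have "poly u' b * poly v b = 0"
      using arg_cong[OF 1, of "\<lambda>r. poly r b"] by simp
    then consider "poly u' b = 0" | "poly v b = 0" by auto
    then show ?thesis
    proof cases
      case 1
      then obtain w where w: "u' = [:- b, 1:] * w"
        unfolding poly_eq_0_iff_dvd by (elim dvdE)
      have "[:- b, 1:] * (w * v) = [:- b, 1:] * 1"
        using \<open>u' * v = _\<close> unfolding w by (simp only: mult.assoc mult_1_right)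
      then have "w * v = 1" by (subst (asm) mult_cancel_left) simp
      then show ?thesis unfolding u' w mult.assoc by blast
    next
      case 2
      then obtain w where w: "v = [:- b, 1:] * w"
        unfolding poly_eq_0_iff_dvd by (elim dvdE)
      have "[:- b, 1:] * (u' * w) = [:- b, 1:] * 1"
        using \<open>u' * v = _\<close> unfolding w by (simp only: mult.left_commute[of u'] mult_1_right)
      then have "u' * w = 1" by (subst (asm) mult_cancel_left) simp
      then show ?thesis unfolding u' w by blast
    qed
  qed
  have "poly u a * poly v a = 0"
    using arg_cong[OF assms(1), of "\<lambda>r. poly r a"] by simp
  then consider "poly u a = 0" | "poly v a = 0" by auto
  then show ?thesis
  proof cases
    case 1
    then show ?thesis using key[OF assms(1)] that by blast
  next
    case 2
    have "v * u = [:- a, 1:] * [:- b, 1:]" using assms(1) by (simp only: mult.commute)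
    from key[OF this 2] obtain w w' where "w * w' = 1"
      "v = [:- a, 1:] * [:- b, 1:] * w \<and> u = w' \<or> v = [:- a, 1:] * w \<and> u = [:- b, 1:] * w'"
      by blast
    then show ?thesis using that[of w' w] by (simp only: mult.commute[of w' w]) blast
  qed
qed

section \<open>Kronecker substitution with one variable kept apart\<close>

definition wt2 :: "nat \<Rightarrow> nat \<Rightarrow> (nat \<Rightarrow>\<^sub>0 nat) \<Rightarrow> nat" where
  "wt2 B n a = (\<Sum>i=1..<n. Poly_Mapping.lookup a i * B ^ i)"

text \<open>
  The Kronecker substitution, except that \<open>x\<^sub>0\<close> is kept as the variable of the outer polynomial: the
  forms \<open>p0\<close> and \<open>q0\<close> below become linear in it, hence prime.
\<close>

definition kron2 :: "nat \<Rightarrow> nat \<Rightarrow> cpoly \<Rightarrow> complex poly poly" where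
  "kron2 B n = linear_extension (\<lambda>a c.
    Polynomial.monom (Polynomial.monom c (wt2 B n a)) (Poly_Mapping.lookup a 0))"

lemma wt2_add: "wt2 B n (a + b) = wt2 B n a + wt2 B n b"
  by (simp add: wt2_def lookup_add sum.distrib algebra_simps)

lemma wt2_single: "wt2 B n (Poly_Mapping.single i k) = (if 1 \<le> i \<and> i < n then k * B ^ i else 0)"
proof -
  have "Poly_Mapping.lookup (Poly_Mapping.single i k) j * B ^ j = (if j = i then k * B ^ i else 0)" for j
    by (auto simp: lookup_single when_def)
  then show ?thesis by (simp add: wt2_def)
qed

lemma kron2_add: "kron2 B n (p + q) = kron2 B n p + kron2 B n q"
  unfolding kron2_def by (rule linear_extension_add) (auto simp: add_monom)

lemma kron2_mult: "kron2 B n (p * q) = kron2 B n p * kron2 B n q"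
  unfolding kron2_def
  by (rule linear_extension_mult) (auto simp: add_monom mult_monom wt2_add lookup_add)

lemma kron2_single: "kron2 B n (Poly_Mapping.single a c) =
    Polynomial.monom (Polynomial.monom c (wt2 B n a)) (Poly_Mapping.lookup a 0)"
  unfolding kron2_def by (rule linear_extension_single) simp

text \<open>The variable kept apart has weight \<open>B ^ 0 = 1\<close>, so replacing it by
  \<open>t\<close> restores the full substitution.\<close>

lemma poly_kron2:
  assumes "n > 0"
  shows "poly (kron2 B n p) [:0, 1:] = kron B n p"
proof -
  have "wt B n a = wt2 B n a + Poly_Mapping.lookup a 0" for a
    using assms unfolding wt_def wt2_def lessThan_atLeast0
    by (simp add: sum.atLeast_Suc_lessThan)
  moreover have "[:0, 1:] ^ k = Polynomial.monom (1 :: complex) k" for k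
    using monom_altdef[of "1 :: complex" k] by simp
  ultimately show ?thesis
    unfolding kron2_def kron_def linear_extension_def poly_sum poly_monom
    by (simp add: mult_monom)
qed

lemma pCons_minus_1: "[:- 1:] = (- 1 :: 'a :: comm_ring_1 poly)"
  by (rule poly_eqI) (simp add: coeff_pCons split: nat.split)

lemma pCons_add_1: "pCons a p + 1 = pCons (a + 1) (p :: 'a :: comm_ring_1 poly)"
  by (rule poly_eqI) (simp add: coeff_pCons split: nat.split)

context forms
begin

text \<open>
  \<open>p0\<close> is \<open>x\<^sub>n\<^sub>-\<^sub>1\<^sup>d - x\<^sub>0 x\<^sub>n\<^sup>d\<^sup>-\<^sup>1\<close> and \<open>q0\<close> is \<open>p0 + x\<^sub>n\<^sup>d\<close>; their Kronecker images are \<open>t\<^sup>N - t\<close> and \<open>t\<^sup>N - t + 1\<close>.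
\<close>

definition p0 :: cpoly where
  "p0 = Poly_Mapping.single (lead_monom n d) 1 +
    Poly_Mapping.single (Poly_Mapping.single n (d - 1) + Poly_Mapping.single 0 1) (- 1)"

definition q0 :: cpoly where
  "q0 = p0 + Poly_Mapping.single (Poly_Mapping.single n d) 1"

lemma kron_p0: "kron B n p0 = Polynomial.monom 1 N - [:0, 1:]"
  unfolding p0_def using n
  by (simp add: kron_add kron_single wt_lead_monom wt_add wt_single N_def monom_Suc monom_0 pCons_minus_1)

lemma kron_q0: "kron B n q0 = Polynomial.monom 1 N - [:0, 1:] + 1"
  unfolding q0_def kron_add kron_p0 by (simp add: kron_single wt_single monom_0)

text \<open>As \<open>n - 1 \<ge> 1\<close>, the leading variable differs from the outer one and
  contributes the inner constant \<open>t^N\<close>. The outer variable has coefficient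
  \<open>-1\<close>, whence the sign.\<close>

lemma kron2_p0: "kron2 B n p0 = - [:- Polynomial.monom 1 N, 1:]"
proof -
  have "Suc 0 \<le> n - Suc 0" using n by simp
  then show ?thesis
    unfolding p0_def using n
    by (simp add: kron2_add kron2_single wt2_add wt2_single N_def lookup_add lookup_single monom_0
      monom_Suc pCons_minus_1 del: single_one)
qed

lemma kron2_q0: "kron2 B n q0 = - [:- (Polynomial.monom 1 N + 1), 1:]"
  unfolding q0_def kron2_add kron2_p0 using n
  by (simp add: kron2_single wt2_single lookup_single monom_0 pCons_add_1)

lemma p0_q0_monic: "p0 \<in> monic_forms n d" "q0 \<in> monic_forms n d"
proof -
  have "Poly_Mapping.single n (d - 1) + Poly_Mapping.single 0 1 \<in> Mon n (d - 1 + 1)"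
    by (intro Mon_add Mon_single) auto
  then have "Poly_Mapping.single n (d - 1) + Poly_Mapping.single 0 1 \<in> Mon n d"
    using d by simp
  then have S: "p0 \<in> Sym n d" "q0 \<in> Sym n d"
    unfolding p0_def q0_def by (auto intro!: Sym_add Sym_single Mon_single)
  have "coeff (kron B n p0) N = 1" "coeff (kron B n q0) N = 1"
    using N_ge_2 by (auto simp: kron_p0 kron_q0 coeff_pCons split: nat.split)
  then show "p0 \<in> monic_forms n d" "q0 \<in> monic_forms n d"
    using coeff_kron_lead[OF S(1) d_less_B(1,3)] coeff_kron_lead[OF S(2) d_less_B(1,3)] S
    unfolding monic_forms_def N_def by auto
qed

lemma unit_cpoly_poly:
  fixes w w' :: "complex poly poly"
  assumes "w * w' = 1"
  obtains c where "w = [:[:c:]:]"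
proof -
  have "w dvd 1" using assms by (metis dvd_triv_left)
  then obtain a where a: "w = [:a:]" "a dvd 1" unfolding poly_dvd_1 by (auto elim: degree_eq_zeroE)
  then obtain c where "a = [:c:]" unfolding poly_dvd_1 by (auto elim: degree_eq_zeroE)
  then show ?thesis using a that by blast
qed

text \<open>In two variables both factors become linear, so a factorization can only distribute
  them, up to units. Giving both to one side leaves a constant, which no monic form of degree
  \<open>d\<close> maps to.\<close>

lemma unique_factors_p0_q0: "unique_factors p0 q0"
  unfolding unique_factors_def
proof (intro conjI ballI impI)
  fix p q assume p: "p \<in> monic_forms n d" and q: "q \<in> monic_forms n d" and eq: "p * q = p0 * q0"
  let ?a = "Polynomial.monom (1 :: complex) N"
  have monic: "degree (kron B n r) = N \<and> lead_coeff (kron B n r) = 1" if "r \<in> monic_forms n d" for r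
    using that unfolding monic_forms_iff[OF d_less_B(1,3)] N_def by blast
  \<comment> \<open>Comparing leading coefficients after the full substitution forces the unit
    \<open>c\<close> to be \<open>-1\<close>.\<close>
  have same: "r = s" if "r \<in> monic_forms n d" "s \<in> monic_forms n d" "kron2 B n r = - kron2 B n s * [:[:c:]:]"
    for r s c
  proof -
    have k: "kron B n r = kron B n s * [:- c:]"
      using arg_cong[OF that(3), of "\<lambda>u. poly u [:0, 1:]"] poly_kron2[OF d_less_B(3)] by simp
    have "lead_coeff (kron B n r) = lead_coeff (kron B n s) * - c"
      unfolding k lead_coeff_mult by simp
    moreover have "lead_coeff (kron B n r) = 1" "lead_coeff (kron B n s) = 1"
      using monic[OF that(1)] monic[OF that(2)] by blast+
    ultimately have "1 = - c" by (simp only: mult_1)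
    then have "c = - 1" by (simp add: minus_equation_iff)
    then have "kron B n r = kron B n s" using k by simp
    then show ?thesis
      using kron_inject[OF _ _ d_less_B(1)] that(1,2) unfolding monic_forms_def by blast
  qed
  have nonconst: "kron2 B n r \<noteq> [:[:c:]:]" if "r \<in> monic_forms n d" for r c
  proof
    assume "kron2 B n r = [:[:c:]:]"
    then have "kron B n r = [:c:]"
      using poly_kron2[OF d_less_B(3), of B r] by simp
    then show False using monic[OF that] N_ge_2 by simp
  qed
  have "kron2 B n p * kron2 B n q = [:- ?a, 1:] * [:- (?a + 1), 1:]"
    unfolding kron2_mult[symmetric] eq unfolding kron2_mult kron2_p0 kron2_q0 by (simp only: minus_mult_minus)
  then obtain w w' where w: "w * w' = 1" and
    cases: "kron2 B n p = [:- ?a, 1:] * [:- (?a + 1), 1:] * w \<and> kron2 B n q = w' \<or>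
      kron2 B n p = [:- ?a, 1:] * w \<and> kron2 B n q = [:- (?a + 1), 1:] * w' \<or>
      kron2 B n p = [:- (?a + 1), 1:] * w \<and> kron2 B n q = [:- ?a, 1:] * w' \<or>
      kron2 B n p = w \<and> kron2 B n q = [:- ?a, 1:] * [:- (?a + 1), 1:] * w'"
    by (rule split_linear_factors) simp
  obtain c where c: "w = [:[:c:]:]" using unit_cpoly_poly[OF w] .
  obtain c' where c': "w' = [:[:c':]:]" using unit_cpoly_poly[of w' w] w unfolding mult.commute[of w' w] by blast
  have lin: "[:- ?a, 1:] = - kron2 B n p0" "[:- (?a + 1), 1:] = - kron2 B n q0"
    unfolding kron2_p0 kron2_q0 by simp_all
  from cases show "p = p0 \<and> q = q0 \<or> p = q0 \<and> q = p0"
    unfolding lin c c'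
  proof (elim disjE conjE)
    assume "kron2 B n p = - kron2 B n p0 * [:[:c:]:]" "kron2 B n q = - kron2 B n q0 * [:[:c':]:]"
    then show ?thesis
      using same[OF p p0_q0_monic(1)] same[OF q p0_q0_monic(2)] by blast
  next
    assume "kron2 B n p = - kron2 B n q0 * [:[:c:]:]" "kron2 B n q = - kron2 B n p0 * [:[:c':]:]"
    then show ?thesis
      using same[OF p p0_q0_monic(2)] same[OF q p0_q0_monic(1)] by blast
  qed (use nonconst[OF p] nonconst[OF q] in blast)+
qed (rule p0_q0_monic)+

text \<open>With \<open>k = t^N - t\<close> the product is \<open>k * (k + 1)\<close>, with
  derivative \<open>k' * (2 * k + 1)\<close>. At a root \<open>k\<close> is 0 or -1, so the second
  factor is 1 or -1, and it remains to see that \<open>k'\<close> does not vanish.\<close>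

lemma p0_q0_squarefree:
  assumes "poly (kron B n (p0 * q0)) a = 0"
  shows "poly (pderiv (kron B n (p0 * q0))) a \<noteq> 0"
proof -
  let ?k = "Polynomial.monom 1 N - [:0, 1:] :: complex poly"
  have k: "poly ?k a = a ^ N - a" by (simp add: poly_monom)
  have k': "poly (pderiv ?k) a = of_nat N * a ^ (N - 1) - 1"
    by (simp add: pderiv_diff pderiv_monom pderiv_pCons poly_monom)
  have aN: "a ^ N = a ^ (N - 1) * a"
    using N_ge_2 by (simp add: power_eq_if)
  have prod: "kron B n (p0 * q0) = ?k * (?k + 1)"
    by (simp add: kron_mult kron_p0 kron_q0)
  have der: "poly (pderiv (kron B n (p0 * q0))) a = poly (pderiv ?k) a * (2 * poly ?k a + 1)"
    unfolding prod pderiv_mult pderiv_add by (simp add: algebra_simps)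
  consider "poly ?k a = 0" | "poly ?k a = - 1"
    using assms unfolding prod by (auto simp: eq_neg_iff_add_eq_0)
  then show ?thesis
  proof cases
    case 1
    then have "a * (a ^ (N - 1) - 1) = 0" unfolding k aN by (simp add: algebra_simps)
    then consider "a = 0" | "a ^ (N - 1) = 1" by auto
    then have "poly (pderiv ?k) a \<noteq> 0"
    proof cases
      case 1
      then show ?thesis unfolding k' using N_ge_2 by (simp add: power_0_left)
    next
      case 2
      then show ?thesis unfolding k' using N_ge_2 by simp
    qed
    then show ?thesis unfolding der 1 by simp
  next
    case 2
    have "of_nat N * a ^ (N - 1) - 1 \<noteq> 0"
    proof
      assume *: "of_nat N * a ^ (N - 1) - 1 = 0"
      then have N1: "of_nat N * a ^ (N - 1) = 1" by simp
      \<comment> \<open>Multiplying by \<open>N\<close> and using \<open>N * a ^ (N - 1) = 1\<close>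
        gives \<open>a * (N - 1) = N\<close>. Hence \<open>a\<close> has modulus at least 1, which
        contradicts \<open>N * a ^ (N - 1) = 1\<close> because \<open>N \<ge> 2\<close>.\<close>
      have "a - 1 = a ^ N"
        using 2 unfolding k by (simp add: algebra_simps)
      then have "of_nat N * (a - 1) = of_nat N * a ^ N" by simp
      also have "\<dots> = a" unfolding aN mult.assoc[symmetric] N1 by simp
      finally have "a * of_nat (N - 1) = of_nat N"
        using N_ge_2 by (simp add: of_nat_diff algebra_simps)
      then have na: "norm a * real (N - 1) = real N"
        using norm_mult[of a "of_nat (N - 1)"] by (simp only: norm_of_nat)
      have "1 \<le> norm a"
      proof (rule ccontr)
        assume "\<not> 1 \<le> norm a"
        then have "norm a * real (N - 1) \<le> 1 * real (N - 1)"
          by (intro mult_right_mono) auto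
        then show False unfolding na using N_ge_2 by simp
      qed
      then have "1 \<le> norm a ^ (N - 1)" by (rule one_le_power)
      then have "real N \<le> real N * norm a ^ (N - 1)"
        using mult_left_mono[of 1 "norm a ^ (N - 1)" "real N"] by simp
      also have "\<dots> = norm (of_nat N * a ^ (N - 1))" by (simp add: norm_mult norm_power)
      also have "\<dots> = 1" unfolding N1 by simp
      finally show False using N_ge_2 by simp
    qed
    then show ?thesis unfolding der 2 k' by simp
  qed
qed

lemma p0_q0_not_bad: "p0 * q0 \<notin> fst ` labelled_bad"
  using not_bad_if_unique_factors[OF unique_factors_p0_q0 p0_q0_squarefree] .

end

section \<open>The fibres\<close>

abbreviation const_poly :: "complex \<Rightarrow> cpoly" where
  "const_poly c \<equiv> Poly_Mapping.single 0 c"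

lemma const_poly_mult: "const_poly a * (const_poly b * p) = const_poly (a * b) * p"
  by (simp add: mult_single flip: mult.assoc)

lemma const_poly_ii: "const_poly \<i> * const_poly \<i> = - 1"
  by (simp add: mult_single single_uminus)

lemma sum_two_squares: "(\<Sum>j<2::nat. (g j)\<^sup>2) =
    (g 0 + const_poly \<i> * g (Suc 0)) * (g 0 - const_poly \<i> * g (Suc 0))"
proof -
  have "(g 0 + const_poly \<i> * g (Suc 0)) * (g 0 - const_poly \<i> * g (Suc 0)) =
      (g 0)\<^sup>2 - (const_poly \<i> * const_poly \<i>) * (g (Suc 0))\<^sup>2"
    by (simp add: algebra_simps power2_eq_square)
  then show ?thesis
    by (simp add: const_poly_ii numeral_2_eq_2)
qed

text \<open>The inverse of the change of variables from \<open>g\<close> to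
  \<open>u = g 0 + i g 1\<close> and \<open>v = g 0 - i g 1\<close>; the constant
  \<open>- \<i> / 2\<close> is \<open>1 / (2 * \<i>)\<close>. Restriction makes the result an
  extensional tuple.\<close>

definition half_sums :: "cpoly \<Rightarrow> cpoly \<Rightarrow> nat \<Rightarrow> cpoly" where
  "half_sums u v = (\<lambda>j\<in>{..<2}. if j = 0 then const_poly (1 / 2) * (u + v)
    else const_poly (- \<i> / 2) * (u - v))"

lemma lookup_half_sums:
  "Poly_Mapping.lookup (half_sums u v 0) a = (Poly_Mapping.lookup u a + Poly_Mapping.lookup v a) / 2"
  "Poly_Mapping.lookup (half_sums u v (Suc 0)) a =
    - \<i> * (Poly_Mapping.lookup u a - Poly_Mapping.lookup v a) / 2"
  by (simp_all add: half_sums_def lookup_add lookup_minus lookup_single_0_mult)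

lemma half_sums:
  "half_sums u v 0 + const_poly \<i> * half_sums u v (Suc 0) = u"
  "half_sums u v 0 - const_poly \<i> * half_sums u v (Suc 0) = v"
  by (rule poly_mapping_eqI, simp only: lookup_half_sums lookup_add lookup_minus lookup_single_0_mult,
    simp add: field_simps)+

lemma half_sums_eq:
  assumes "g \<in> extensional {..<2}"
  shows "half_sums (g 0 + const_poly \<i> * g (Suc 0)) (g 0 - const_poly \<i> * g (Suc 0)) = g"
proof (rule ext)
  fix j :: nat
  consider "j = 0" | "j = Suc 0" | "j \<notin> {..<2}" by fastforce
  then show "half_sums (g 0 + const_poly \<i> * g (Suc 0)) (g 0 - const_poly \<i> * g (Suc 0)) j = g j"
  proof cases
    case 1
    show ?thesis
      unfolding 1
      by (rule poly_mapping_eqI)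
        (simp only: lookup_half_sums lookup_add lookup_minus lookup_single_0_mult, simp add: field_simps)
  next
    case 2
    show ?thesis
      unfolding 2
      by (rule poly_mapping_eqI)
        (simp only: lookup_half_sums lookup_add lookup_minus lookup_single_0_mult, simp add: field_simps)
  next
    case 3
    then show ?thesis using assms by (auto simp: half_sums_def extensional_def)
  qed
qed

lemma half_sums_mem: "u \<in> Sym n d \<Longrightarrow> v \<in> Sym n d \<Longrightarrow> half_sums u v \<in> (\<Pi>\<^sub>E j\<in>{..<2}. Sym n d)"
  by (auto simp: half_sums_def intro!: Sym_scale Sym_add Sym_diff)

lemma sum_squares_half_sums: "(\<Sum>j<2::nat. (half_sums u v j)\<^sup>2) = u * v"
  by (simp only: sum_two_squares half_sums)

lemma sums_of_two_squares_eq_products: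
  "{(\<Sum>j<2::nat. (g j)\<^sup>2) | g. \<forall>j<2::nat. g j \<in> Sym n d} = {u * v | u v. u \<in> Sym n d \<and> v \<in> Sym n d}"
proof (intro subset_antisym subsetI)
  fix f assume "f \<in> {(\<Sum>j<2::nat. (g j)\<^sup>2) | g. \<forall>j<2::nat. g j \<in> Sym n d}"
  then obtain g where g: "f = (\<Sum>j<2::nat. (g j)\<^sup>2)" "\<forall>j<2::nat. g j \<in> Sym n d" by blast
  have "g 0 + const_poly \<i> * g (Suc 0) \<in> Sym n d" "g 0 - const_poly \<i> * g (Suc 0) \<in> Sym n d"
    using g(2) by (auto intro!: Sym_add Sym_diff Sym_scale)
  then show "f \<in> {u * v | u v. u \<in> Sym n d \<and> v \<in> Sym n d}"
    unfolding g(1) sum_two_squares by blast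
next
  fix f assume "f \<in> {u * v | u v. u \<in> Sym n d \<and> v \<in> Sym n d}"
  then obtain u v where "f = u * v" "u \<in> Sym n d" "v \<in> Sym n d" by blast
  then show "f \<in> {(\<Sum>j<2::nat. (g j)\<^sup>2) | g. \<forall>j<2::nat. g j \<in> Sym n d}"
    using half_sums_mem[of u n d v]
    by (intro CollectI exI[of _ "half_sums u v"]) (auto simp: sum_squares_half_sums)
qed

text \<open>Clears denominators: a polynomial condition on the normalized form becomes one on the
  form itself, wherever the leading coefficient \<open>L f\<close> is nonzero.\<close>

lemma polynomial_functions_rescale:
  assumes "F \<in> polynomial_functions Defs.coeffs" and L: "L \<in> polynomial_functions Defs.coeffs"
  shows "\<exists>k. \<exists>G\<in>polynomial_functions Defs.coeffs. \<forall>f. L f \<noteq> 0 \<longrightarrow>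
    G f = L f ^ k * F (const_poly (1 / L f) * f)"
  using assms(1)
proof induction
  case (coord c)
  then obtain a where a: "c = (\<lambda>p. Poly_Mapping.lookup p a)" by (auto simp: Defs.coeffs_def)
  show ?case
    by (rule exI[of _ 1], rule bexI[OF _ polynomial_functions.coord[OF coord]])
      (simp add: a lookup_single_0_mult)
next
  case (const a)
  show ?case
    by (rule exI[of _ 0], rule bexI[OF _ polynomial_functions.const[of a]]) simp
next
  case (add F F')
  then obtain k G k' G' where
    G: "G \<in> polynomial_functions Defs.coeffs" "\<forall>f. L f \<noteq> 0 \<longrightarrow> G f = L f ^ k * F (const_poly (1 / L f) * f)"
    and G': "G' \<in> polynomial_functions Defs.coeffs"
      "\<forall>f. L f \<noteq> 0 \<longrightarrow> G' f = L f ^ k' * F' (const_poly (1 / L f) * f)"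
    by blast
  have pow: "(\<lambda>f. L f ^ e) \<in> polynomial_functions Defs.coeffs" for e
    by (induction e) (auto intro: L polynomial_functions.const polynomial_functions.mult)
  show ?case
  proof (rule exI[of _ "k + k'"], rule bexI)
    show "(\<lambda>f. L f ^ k' * G f + L f ^ k * G' f) \<in> polynomial_functions Defs.coeffs"
      by (intro polynomial_functions.add polynomial_functions.mult pow G(1) G'(1))
  qed (use G(2) G'(2) in \<open>simp add: power_add algebra_simps\<close>)
next
  case (mult F F')
  then obtain k G k' G' where
    G: "G \<in> polynomial_functions Defs.coeffs" "\<forall>f. L f \<noteq> 0 \<longrightarrow> G f = L f ^ k * F (const_poly (1 / L f) * f)"
    and G': "G' \<in> polynomial_functions Defs.coeffs"
      "\<forall>f. L f \<noteq> 0 \<longrightarrow> G' f = L f ^ k' * F' (const_poly (1 / L f) * f)"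
    by blast
  show ?case
    by (rule exI[of _ "k + k'"], rule bexI[OF _ polynomial_functions.mult[OF G(1) G'(1)]])
      (use G(2) G'(2) in \<open>simp add: power_add algebra_simps\<close>)
qed

lemma coeff_mult_bounded:
  assumes "degree p \<le> m" "degree q \<le> n"
  shows "coeff (p * q) (m + n) = coeff p m * coeff q n"
proof (cases "degree p = m \<and> degree q = n")
  case True
  then show ?thesis using coeff_mult_degree_sum[of p q] by simp
next
  case False
  then have "degree (p * q) < m + n" "coeff p m * coeff q n = 0"
    using assms degree_mult_le[of p q] by (auto simp: coeff_eq_0)
  then show ?thesis by (simp add: coeff_eq_0)
qed

section \<open>Coordinates on SO(2)\<close>

lemma SO2_iff:
  "A \<in> SO2 \<longleftrightarrow> vec_nth (vec_nth A 2) 2 = vec_nth (vec_nth A 1) 1 \<and>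
    vec_nth (vec_nth A 1) 2 = - vec_nth (vec_nth A 2) 1 \<and>
    (vec_nth (vec_nth A 1) 1)\<^sup>2 + (vec_nth (vec_nth A 2) 1)\<^sup>2 = 1"
proof -
  obtain x y z w where A: "vec_nth (vec_nth A 1) 1 = x" "vec_nth (vec_nth A 1) 2 = y"
    "vec_nth (vec_nth A 2) 1 = z" "vec_nth (vec_nth A 2) 2 = w" by blast
  have mem: "A \<in> SO2 \<longleftrightarrow> x * x + z * z = 1 \<and> x * y + z * w = 0 \<and> y * y + w * w = 1 \<and> x * w - y * z = 1"
    unfolding SO2_def
    by (auto simp: Finite_Cartesian_Product.vec_eq_iff forall_2 matrix_matrix_mult_def Finite_Cartesian_Product.transpose_def
      Finite_Cartesian_Product.mat_def sum_2 det_2 A algebra_simps)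
  show ?thesis
    unfolding mem A
  proof
    assume *: "x * x + z * z = 1 \<and> x * y + z * w = 0 \<and> y * y + w * w = 1 \<and> x * w - y * z = 1"
    \<comment> \<open>These combinations solve the equations for the second column; the factor
      \<open>x * x + z * z\<close> is 1.\<close>
    have "w * (x * x + z * z) = x * (x * w - y * z) + z * (x * y + z * w)"
      "y * (x * x + z * z) = x * (x * y + z * w) - z * (x * w - y * z)"
      by (simp_all add: algebra_simps)
    then have "w = x" "y = - z" using * by simp_all
    then show "w = x \<and> y = - z \<and> x\<^sup>2 + z\<^sup>2 = 1" using * by (simp add: power2_eq_square)
  next
    assume "w = x \<and> y = - z \<and> x\<^sup>2 + z\<^sup>2 = 1"
    then show "x * x + z * z = 1 \<and> x * y + z * w = 0 \<and> y * y + w * w = 1 \<and> x * w - y * z = 1"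
      by (auto simp: power2_eq_square algebra_simps)
  qed
qed

definition rotation :: "complex \<Rightarrow> complex \<Rightarrow> complex^2^2" where
  "rotation a b = (\<chi> i j. if i = 1 then if j = 1 then a else - b else if j = 1 then b else a)"

lemma rotation_nth:
  "vec_nth (vec_nth (rotation a b) 1) 1 = a" "vec_nth (vec_nth (rotation a b) 1) 2 = - b"
  "vec_nth (vec_nth (rotation a b) 2) 1 = b" "vec_nth (vec_nth (rotation a b) 2) 2 = a"
  by (simp_all add: rotation_def)

lemma rotation_SO2: "rotation a b \<in> SO2 \<longleftrightarrow> a\<^sup>2 + b\<^sup>2 = 1"
  by (simp add: SO2_iff rotation_nth)

lemma SO2_eq_rotation:
  "A \<in> SO2 \<Longrightarrow> A = rotation (vec_nth (vec_nth A 1) 1) (vec_nth (vec_nth A 2) 1)"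
  unfolding SO2_iff by (simp add: Finite_Cartesian_Product.vec_eq_iff forall_2 rotation_nth)

section \<open>The two branches of a fibre\<close>

context forms
begin

definition lead :: "cpoly \<Rightarrow> complex" where
  "lead u = Poly_Mapping.lookup u (lead_monom n d)"

definition lead2 :: "cpoly \<Rightarrow> complex" where
  "lead2 f = Poly_Mapping.lookup f (lead_monom n (2 * d))"

lemma lead2_mult:
  assumes "u \<in> Sym n d" "v \<in> Sym n d"
  shows "lead2 (u * v) = lead u * lead v"
proof -
  have S: "u * v \<in> Sym n (2 * d)"
    using Sym_mult[OF assms] by (simp add: mult_2)
  have "coeff (kron B n u * kron B n v) (N + N) = coeff (kron B n u) N * coeff (kron B n v) N"
    using degree_kron_le[OF assms(1), of B] degree_kron_le[OF assms(2), of B] d_less_B(1)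
    by (intro coeff_mult_bounded) (auto simp: N_def)
  moreover have "2 * d * B ^ (n - 1) = N + N" by (simp add: N_def)
  ultimately show ?thesis
    using coeff_kron_lead[OF S d_less_B(2,3)] coeff_kron_lead[OF assms(1) d_less_B(1,3)]
      coeff_kron_lead[OF assms(2) d_less_B(1,3)]
    by (simp only: lead_def lead2_def kron_mult N_def[symmetric])
qed

lemma lead_scale: "lead (const_poly c * u) = c * lead u"
  by (simp add: lead_def lookup_single_0_mult)

lemma monic_lead: "u \<in> monic_forms n d \<Longrightarrow> lead u = 1"
  by (simp add: monic_forms_def lead_def)

lemma monic_scale: "u \<in> Sym n d \<Longrightarrow> lead u \<noteq> 0 \<Longrightarrow> const_poly (1 / lead u) * u \<in> monic_forms n d"
  by (simp add: monic_forms_def Sym_scale lookup_single_0_mult lead_def)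

lemma scale_mult:
  assumes "u \<in> Sym n d" "v \<in> Sym n d"
  shows "(const_poly (1 / lead u) * u) * (const_poly (1 / lead v) * v) =
    const_poly (1 / lead2 (u * v)) * (u * v)"
proof -
  have "(const_poly (1 / lead u) * u) * (const_poly (1 / lead v) * v) =
      (const_poly (1 / lead u) * const_poly (1 / lead v)) * (u * v)"
    by (simp only: ac_simps)
  then show ?thesis
    by (simp add: mult_single lead2_mult[OF assms])
qed

text \<open>The factorization of \<open>f\<close> into \<open>s p\<close> and
  \<open>(c / s) q\<close>, in the coordinates of the two squares. Here \<open>c\<close> will be the
  leading coefficient of \<open>f\<close>; since \<open>p\<close> is monic, \<open>s\<close> can be
  read off as a leading coefficient.\<close>

definition branch :: "complex \<Rightarrow> cpoly \<Rightarrow> cpoly \<Rightarrow> complex \<Rightarrow> nat \<Rightarrow> cpoly" where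
  "branch c p q s = half_sums (const_poly s * p) (const_poly (c / s) * q)"

text \<open>Dividing the two factors \<open>u\<close> and \<open>v\<close> of \<open>f\<close> by
  their leading coefficients gives monic factors of the normalized \<open>f\<close>, so uniqueness
  applies; the parameter is the leading coefficient of \<open>u\<close>.\<close>

lemma SOS_fibre_eq_branches:
  assumes c: "lead2 f = c" "c \<noteq> 0" and pq: "unique_factors p q" "p * q = const_poly (1 / c) * f"
  shows "SOS_fibre n d 2 f = branch c p q ` (- {0}) \<union> branch c q p ` (- {0})"
proof (intro subset_antisym subsetI)
  fix g assume "g \<in> SOS_fibre n d 2 f"
  then have g: "g \<in> (\<Pi>\<^sub>E j\<in>{..<2}. Sym n d)" and f: "(\<Sum>j<2::nat. (g j)\<^sup>2) = f"
    unfolding SOS_fibre_def by blast+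
  define u where "u = g 0 + const_poly \<i> * g (Suc 0)"
  define v where "v = g 0 - const_poly \<i> * g (Suc 0)"
  have S: "u \<in> Sym n d" "v \<in> Sym n d"
    unfolding u_def v_def by (intro Sym_add Sym_diff Sym_scale PiE_mem[OF g]; simp)+
  have uv: "u * v = f"
    using f unfolding sum_two_squares u_def v_def .
  have lead: "lead u * lead v = c"
    using lead2_mult[OF S] c(1) uv by simp
  then have ne: "lead u \<noteq> 0" "lead v \<noteq> 0" using c(2) by auto
  have "(const_poly (1 / lead u) * u) * (const_poly (1 / lead v) * v) = p * q"
    unfolding scale_mult[OF S] pq(2) uv c(1) ..
  then have "const_poly (1 / lead u) * u = p \<and> const_poly (1 / lead v) * v = q \<or>
      const_poly (1 / lead u) * u = q \<and> const_poly (1 / lead v) * v = p"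
    using pq(1) monic_scale[OF S(1) ne(1)] monic_scale[OF S(2) ne(2)]
    unfolding unique_factors_def by blast
  moreover have "const_poly (lead u) * (const_poly (1 / lead u) * u) = u"
    "const_poly (c / lead u) * (const_poly (1 / lead v) * v) = v"
    using ne by (simp_all add: const_poly_mult lead[symmetric])
  moreover have "half_sums u v = g"
    using g unfolding u_def v_def by (intro half_sums_eq) (auto simp: PiE_def)
  ultimately have "g = branch c p q (lead u) \<or> g = branch c q p (lead u)"
    unfolding branch_def by metis
  then show "g \<in> branch c p q ` (- {0}) \<union> branch c q p ` (- {0})"
    using ne(1) by blast
next
  fix g assume "g \<in> branch c p q ` (- {0}) \<union> branch c q p ` (- {0})"
  then obtain s p' q' where s: "s \<noteq> 0" "g = branch c p' q' s" and
    p'q': "p' = p \<and> q' = q \<or> p' = q \<and> q' = p" by blast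
  have S: "p' \<in> Sym n d" "q' \<in> Sym n d"
    using p'q' pq(1) unfolding unique_factors_def monic_forms_def by auto
  have "(const_poly s * p') * (const_poly (c / s) * q') =
      (const_poly s * const_poly (c / s)) * (p' * q')"
    by (simp only: ac_simps)
  also have "p' * q' = const_poly (1 / c) * f"
    using p'q' pq(2) by (auto simp: mult.commute)
  also have "(const_poly s * const_poly (c / s)) * \<dots> = f"
    using s(1) c(2) by (simp add: mult_single const_poly_mult)
  finally show "g \<in> SOS_fibre n d 2 f"
    unfolding SOS_fibre_def s(2) branch_def
    using S by (auto simp: sum_squares_half_sums simp del: sum.lessThan_Suc
      intro!: half_sums_mem Sym_scale)
qed

lemma lead_branch:
  assumes "p \<in> monic_forms n d" "q \<in> monic_forms n d"
  shows "branch c p q s 0 + const_poly \<i> * branch c p q s (Suc 0) = const_poly s * p"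
    "lead (branch c p q s 0 + const_poly \<i> * branch c p q s (Suc 0)) = s"
    "lead (branch c p q s 0 - const_poly \<i> * branch c p q s (Suc 0)) = c / s"
  using assms unfolding branch_def half_sums by (simp_all add: lead_scale monic_lead)

lemma disjoint_branches:
  assumes "p \<in> monic_forms n d" "q \<in> monic_forms n d" "p \<noteq> q"
  shows "branch c p q ` (- {0}) \<inter> branch c q p ` (- {0}) = {}"
proof (rule ccontr)
  assume "branch c p q ` (- {0}) \<inter> branch c q p ` (- {0}) \<noteq> {}"
  then obtain s t where st: "s \<noteq> 0" "branch c p q s = branch c q p t" by auto
  have eq: "const_poly s * p = const_poly t * q"
    using lead_branch(1)[OF assms(1,2), of c s] lead_branch(1)[OF assms(2,1), of c t] st(2) by simp
  have "s = t"
    using lead_branch(2)[OF assms(1,2), of c s] lead_branch(2)[OF assms(2,1), of c t] st(2) by simp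
  then have "const_poly (1 / s) * (const_poly s * p) = const_poly (1 / s) * (const_poly s * q)"
    using eq by simp
  then show False
    using st(1) assms(3) by (simp add: const_poly_mult)
qed

lemma polynomial_functions_tuple:
  assumes "j < k"
  shows "(\<lambda>g. Poly_Mapping.lookup (g j) a) \<in> polynomial_functions (tuple_coeffs k)"
  using assms by (auto intro!: polynomial_functions.coord simp: tuple_coeffs_def)

lemma polynomial_functions_lookup_factors:
  "(\<lambda>g. Poly_Mapping.lookup (g 0 + const_poly \<i> * g (Suc 0)) a) \<in> polynomial_functions (tuple_coeffs 2)"
  "(\<lambda>g. Poly_Mapping.lookup (g 0 - const_poly \<i> * g (Suc 0)) a) \<in> polynomial_functions (tuple_coeffs 2)"
  unfolding lookup_add lookup_minus lookup_single_0_mult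
  by (intro polynomial_functions.add polynomial_functions_diff polynomial_functions.mult
    polynomial_functions.const polynomial_functions_tuple; simp)+

lemma closedin_branch:
  assumes "p \<in> monic_forms n d" "q \<in> monic_forms n d" "p \<noteq> q"
    and X: "X = branch c p q ` (- {0}) \<union> branch c q p ` (- {0})"
  shows "closedin (zariski (tuple_coeffs 2) X) (branch c p q ` (- {0}))"
proof (rule closedin_zariskiI)
  let ?u = "\<lambda>g. g 0 + const_poly \<i> * g (Suc 0)"
  \<comment> \<open>On the first branch \<open>u = t p\<close> with \<open>t\<close> the leading
    coefficient of \<open>u\<close>, so this vanishes. On the second, \<open>u = s q\<close>, and
    the value is \<open>s\<close> times the difference of the coefficients of \<open>q\<close> and
    \<open>p\<close> at \<open>a\<close>.\<close>
  let ?F = "\<lambda>a g. Poly_Mapping.lookup (?u g) a - lead (?u g) * Poly_Mapping.lookup p a"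
  fix g assume "g \<in> X - branch c p q ` (- {0})"
  then have "g \<in> branch c q p ` (- {0})" unfolding X by blast
  then obtain s where s: "s \<noteq> 0" "g = branch c q p s" by auto
  obtain a where a: "Poly_Mapping.lookup p a \<noteq> Poly_Mapping.lookup q a"
    using assms(3) poly_mapping_eqI[of p q] by auto
  have "?F a \<in> polynomial_functions (tuple_coeffs 2)"
    unfolding lead_def
    by (intro polynomial_functions_diff polynomial_functions.mult polynomial_functions.const
      polynomial_functions_lookup_factors)
  moreover have "?F a h = 0" if h: "h \<in> branch c p q ` (- {0})" for h
  proof -
    obtain t where "h = branch c p q t" using h by auto
    then show ?thesis
      by (simp only: lead_branch(1)[OF assms(1,2)] lead_scale monic_lead[OF assms(1)]
        lookup_single_0_mult mult_1_right diff_self)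
  qed
  moreover have "?F a g \<noteq> 0"
    unfolding s(2) lead_branch(1)[OF assms(2,1)] lead_scale monic_lead[OF assms(2)] lookup_single_0_mult
    using s(1) a by simp
  ultimately show "\<exists>F\<in>polynomial_functions (tuple_coeffs 2).
      (\<forall>x\<in>branch c p q ` (- {0}). F x = 0) \<and> F g \<noteq> 0"
    by (intro bexI[of _ "?F a"] conjI ballI)
qed (simp add: X)

lemma lookup_branch:
  "Poly_Mapping.lookup (branch c p q s 0) a =
    (s * Poly_Mapping.lookup p a + c / s * Poly_Mapping.lookup q a) / 2"
  "Poly_Mapping.lookup (branch c p q s (Suc 0)) a =
    - \<i> * (s * Poly_Mapping.lookup p a - c / s * Poly_Mapping.lookup q a) / 2"
  by (simp_all add: branch_def lookup_half_sums lookup_single_0_mult)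

lemma irreducible_space_branch:
  "irreducible_space (zariski (tuple_coeffs 2) (branch c p q ` (- {0})))"
proof (rule irreducible_space_laurent_curve)
  fix y assume "y \<in> tuple_coeffs 2"
  then obtain j a where y: "y = (\<lambda>g. Poly_Mapping.lookup (g j) a)" "j < 2"
    by (auto simp: tuple_coeffs_def)
  let ?P = "Poly_Mapping.lookup p a" and ?Q = "Poly_Mapping.lookup q a"
  have cancel: "c / s * ?Q * s = c * ?Q" if "s \<noteq> 0" for s
    using that by simp
  have expand: "(s * ?P + c / s * ?Q) / 2 * s = (s * ?P * s + c / s * ?Q * s) / 2"
    "- \<i> * (s * ?P - c / s * ?Q) / 2 * s = - \<i> * (s * ?P * s - c / s * ?Q * s) / 2" for s
    by (simp_all add: algebra_simps)
  have P: "(s * ?P + c / s * ?Q) / 2 * s = poly [:c * ?Q / 2, 0, ?P / 2:] s"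
    "- \<i> * (s * ?P - c / s * ?Q) / 2 * s = poly [:\<i> * c * ?Q / 2, 0, - \<i> * ?P / 2:] s"
    if "s \<noteq> 0" for s
    unfolding expand cancel[OF that] by (simp_all add: algebra_simps)
  consider "j = 0" | "j = Suc 0" using y(2) by linarith
  then show "\<exists>r e. \<forall>s. s \<noteq> 0 \<longrightarrow> y (branch c p q s) * s ^ e = poly r s"
  proof cases
    case 1
    show ?thesis
      unfolding y(1) 1 lookup_branch
      by (intro exI[of _ "[:c * ?Q / 2, 0, ?P / 2:]"] exI[of _ 1] allI impI) (unfold power_one_right, rule P(1))
  next
    case 2
    show ?thesis
      unfolding y(1) 2 lookup_branch
      by (intro exI[of _ "[:\<i> * c * ?Q / 2, 0, - \<i> * ?P / 2:]"] exI[of _ 1] allI impI)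
        (unfold power_one_right, rule P(2))
  qed
qed

text \<open>Both maps are polynomial although \<open>1 / s\<close> occurs in them: on the branch,
  \<open>1 / s\<close> is the leading coefficient of the second factor divided by the constant
  \<open>c\<close>; on SO(2), the inverse of \<open>a + i b\<close> is
  \<open>a - i b\<close>.\<close>

lemma isomorphic_branch_SO2:
  assumes pq: "p \<in> monic_forms n d" "q \<in> monic_forms n d" and c: "c \<noteq> 0"
  shows "isomorphic_varieties (tuple_coeffs 2) (branch c p q ` (- {0})) matrix_entries SO2"
proof -
  let ?u = "\<lambda>g. lead (g 0 + const_poly \<i> * g (Suc 0))"
  let ?v = "\<lambda>g. lead (g 0 - const_poly \<i> * g (Suc 0))"
  define \<phi> where "\<phi> g = rotation ((?u g + ?v g / c) / 2) ((?u g - ?v g / c) / (2 * \<i>))" for g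
  define \<psi> where "\<psi> A = branch c p q (vec_nth (vec_nth A 1) 1 + \<i> * vec_nth (vec_nth A 2) 1)" for A :: "complex^2^2"
  have uv: "?u (branch c p q s) = s" "?v (branch c p q s) = c / s" for s
    using lead_branch[OF pq] by auto
  have \<phi>: "\<phi> (branch c p q s) = rotation ((s + 1 / s) / 2) ((s - 1 / s) / (2 * \<i>))" for s
    unfolding \<phi>_def uv using c by simp
  have inverse: "vec_nth (vec_nth A 1) 1 + \<i> * vec_nth (vec_nth A 2) 1 \<noteq> 0"
    "1 / (vec_nth (vec_nth A 1) 1 + \<i> * vec_nth (vec_nth A 2) 1) =
      vec_nth (vec_nth A 1) 1 - \<i> * vec_nth (vec_nth A 2) 1" if "A \<in> SO2" for A
  proof -
    have prod: "(vec_nth (vec_nth A 1) 1 + \<i> * vec_nth (vec_nth A 2) 1) *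
        (vec_nth (vec_nth A 1) 1 - \<i> * vec_nth (vec_nth A 2) 1) = 1"
      using that unfolding SO2_iff by (simp add: algebra_simps power2_eq_square)
    then show ne: "vec_nth (vec_nth A 1) 1 + \<i> * vec_nth (vec_nth A 2) 1 \<noteq> 0"
      by (metis mult_zero_left zero_neq_one)
    show "1 / (vec_nth (vec_nth A 1) 1 + \<i> * vec_nth (vec_nth A 2) 1) =
        vec_nth (vec_nth A 1) 1 - \<i> * vec_nth (vec_nth A 2) 1"
      by (rule eq_divide_imp[OF ne, symmetric]) (use prod in \<open>simp only: mult.commute\<close>)
  qed
  have entry: "(\<lambda>A. vec_nth (vec_nth A i) j) \<in> polynomial_functions matrix_entries" for i j
    by (rule polynomial_functions.coord, unfold matrix_entries_def) blast
  show ?thesis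
    unfolding isomorphic_varieties_def
  proof (intro exI conjI ballI)
    show "variety_morphism (tuple_coeffs 2) (branch c p q ` (- {0})) matrix_entries SO2 \<phi>"
      unfolding variety_morphism_def
    proof (intro conjI ballI)
      have "((s - t) / (2 * \<i>))\<^sup>2 = - ((s - t)\<^sup>2 / 4)" for s t
        by (simp add: power_divide power_mult_distrib)
      then have "((s + t) / 2)\<^sup>2 + ((s - t) / (2 * \<i>))\<^sup>2 = s * t" for s t
        by (simp add: power2_eq_square field_simps)
      then have "\<phi> (branch c p q s) \<in> SO2" if "s \<noteq> 0" for s
        unfolding \<phi> rotation_SO2 using that by simp
      then show "\<phi> \<in> branch c p q ` (- {0}) \<rightarrow> SO2" by blast
    next
      fix y assume "y \<in> matrix_entries"
      then obtain i j where y: "y = (\<lambda>A. vec_nth (vec_nth A i) j)"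
        unfolding matrix_entries_def by blast
      have a: "(\<lambda>g. (?u g + ?v g / c) / 2) \<in> polynomial_functions (tuple_coeffs 2)"
        and b: "(\<lambda>g. (?u g - ?v g / c) / (2 * \<i>)) \<in> polynomial_functions (tuple_coeffs 2)"
        unfolding divide_inverse lead_def
        by (intro polynomial_functions.add polynomial_functions_diff polynomial_functions.mult
          polynomial_functions.const polynomial_functions_lookup_factors)+
      have "(\<lambda>g. y (\<phi> g)) \<in> polynomial_functions (tuple_coeffs 2)"
        unfolding y \<phi>_def rotation_def vec_lambda_beta
        by (intro polynomial_functions_if polynomial_functions_uminus a b)
      then show "\<exists>F\<in>polynomial_functions (tuple_coeffs 2).
          \<forall>x\<in>branch c p q ` (- {0}). y (\<phi> x) = F x"
        by (rule bexI[rotated]) simp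
    qed
  next
    show "variety_morphism matrix_entries SO2 (tuple_coeffs 2) (branch c p q ` (- {0})) \<psi>"
      unfolding variety_morphism_def
    proof (intro conjI ballI)
      show "\<psi> \<in> SO2 \<rightarrow> branch c p q ` (- {0})"
        unfolding \<psi>_def using inverse(1) by blast
    next
      fix y assume "y \<in> tuple_coeffs 2"
      then obtain j a where y: "y = (\<lambda>g. Poly_Mapping.lookup (g j) a)" "j < 2"
        by (auto simp: tuple_coeffs_def)
      let ?s = "\<lambda>A :: complex^2^2. vec_nth (vec_nth A 1) 1 + \<i> * vec_nth (vec_nth A 2) 1"
      let ?t = "\<lambda>A :: complex^2^2. vec_nth (vec_nth A 1) 1 - \<i> * vec_nth (vec_nth A 2) 1"
      let ?P = "Poly_Mapping.lookup p a" and ?Q = "Poly_Mapping.lookup q a"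
      have st: "?s \<in> polynomial_functions matrix_entries" "?t \<in> polynomial_functions matrix_entries"
        by (intro polynomial_functions.add polynomial_functions_diff polynomial_functions.mult
          polynomial_functions.const entry)+
      have t: "c / ?s A = c * ?t A" if "A \<in> SO2" for A
        unfolding inverse(2)[OF that, symmetric] by simp
      consider "j = 0" | "j = Suc 0" using y(2) by linarith
      then show "\<exists>F\<in>polynomial_functions matrix_entries. \<forall>A\<in>SO2. y (\<psi> A) = F A"
      proof cases
        case 1
        show ?thesis
        proof (rule bexI)
          show "(\<lambda>A. (?s A * ?P + (c * ?t A) * ?Q) * inverse 2) \<in> polynomial_functions matrix_entries"
            by (intro polynomial_functions.add polynomial_functions.mult polynomial_functions.const st)
          show "\<forall>A\<in>SO2. y (\<psi> A) = (?s A * ?P + (c * ?t A) * ?Q) * inverse 2"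
            unfolding \<psi>_def y(1) 1 lookup_branch by (intro ballI, subst t) simp_all
        qed
      next
        case 2
        show ?thesis
        proof (rule bexI)
          show "(\<lambda>A. - \<i> * (?s A * ?P - (c * ?t A) * ?Q) * inverse 2) \<in> polynomial_functions matrix_entries"
            by (intro polynomial_functions_diff polynomial_functions.mult polynomial_functions.const st)
          show "\<forall>A\<in>SO2. y (\<psi> A) = - \<i> * (?s A * ?P - (c * ?t A) * ?Q) * inverse 2"
            unfolding \<psi>_def y(1) 2 lookup_branch by (intro ballI, subst t) simp_all
        qed
      qed
    qed
  next
    fix g assume "g \<in> branch c p q ` (- {0})"
    then obtain s where s: "s \<noteq> 0" "g = branch c p q s" by blast
    have "(s + 1 / s) / 2 + \<i> * ((s - 1 / s) / (2 * \<i>)) = s"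
      by (simp add: field_simps)
    then show "\<psi> (\<phi> g) = g"
      unfolding s(2) \<phi> \<psi>_def rotation_nth by simp
  next
    fix A assume A: "A \<in> SO2"
    show "\<phi> (\<psi> A) = A"
      unfolding \<psi>_def \<phi> inverse(2)[OF A] by (subst (5) SO2_eq_rotation[OF A]) simp
  qed
qed

section \<open>From products to generic points of the closure\<close>

lemma polynomial_functions_lead2: "lead2 \<in> polynomial_functions Defs.coeffs"
  unfolding lead2_def[abs_def] by (rule polynomial_functions.coord) (auto simp: Defs.coeffs_def)

text \<open>Otherwise a polynomial \<open>F\<close> vanishing on the closed set of labelled products
  would be nonzero at the normalized \<open>f\<close>. With denominators cleared it defines a
  neighbourhood of \<open>f\<close>, which contains an actual product \<open>u v\<close> with
  nonzero leading coefficient; but normalizing \<open>u\<close> and \<open>v\<close> puts that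
  product, normalized, into the closed set.\<close>

lemma SOS_monic_product:
  assumes f: "f \<in> SOS n d 2" and c: "lead2 f \<noteq> 0"
  shows "const_poly (1 / lead2 f) * f \<in> monic_forms n (2 * d) \<inter> fst ` labelled_products"
proof (rule IntI)
  let ?X = "zariski Defs.coeffs (Sym n (2 * d))"
  have SOS: "SOS n d 2 = ?X closure_of {u * v | u v. u \<in> Sym n d \<and> v \<in> Sym n d}"
    unfolding SOS_def sums_of_two_squares_eq_products ..
  have S: "f \<in> Sym n (2 * d)"
    using f closure_of_subset_topspace unfolding SOS by fastforce
  then show "const_poly (1 / lead2 f) * f \<in> monic_forms n (2 * d)"
    using c by (simp add: monic_forms_def Sym_scale lookup_single_0_mult lead2_def)
  show "const_poly (1 / lead2 f) * f \<in> fst ` labelled_products"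
  proof (rule ccontr)
    assume "const_poly (1 / lead2 f) * f \<notin> fst ` labelled_products"
    then obtain F where F: "F \<in> polynomial_functions Defs.coeffs"
        "\<forall>x\<in>fst ` labelled_products. F x = 0" "F (const_poly (1 / lead2 f) * f) \<noteq> 0"
      using closedin_products[OF closedin_labelled_products subset_refl]
      unfolding closedin_zariski by blast
    obtain k G where G: "G \<in> polynomial_functions Defs.coeffs"
        "\<forall>f. lead2 f \<noteq> 0 \<longrightarrow> G f = lead2 f ^ k * F (const_poly (1 / lead2 f) * f)"
      using polynomial_functions_rescale[OF F(1) polynomial_functions_lead2] by blast
    let ?T = "{w \<in> Sym n (2 * d). lead2 w * G w \<noteq> 0}"
    have "openin ?X ?T"
      unfolding openin_zariski
      by (rule exI[of _ "{\<lambda>w. lead2 w * G w}"])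
        (auto intro: polynomial_functions.mult polynomial_functions_lead2 G(1))
    moreover have "G f \<noteq> 0"
      unfolding G(2)[rule_format, OF c] using c F(3) by simp
    then have "f \<in> ?T"
      using S c by simp
    ultimately have "\<exists>y. y \<in> {u * v | u v. u \<in> Sym n d \<and> v \<in> Sym n d} \<and> y \<in> ?T"
      using f[unfolded SOS in_closure_of, THEN conjunct2, THEN spec[of _ ?T]] by blast
    then obtain y where y: "y \<in> {u * v | u v. u \<in> Sym n d \<and> v \<in> Sym n d}" "y \<in> ?T"
      by (elim exE conjE)
    from y(1) obtain u v where uv: "y = u * v" "u \<in> Sym n d" "v \<in> Sym n d" by blast
    have ne: "lead2 y \<noteq> 0" "G y \<noteq> 0" using y(2) by auto
    then have "lead u \<noteq> 0" "lead v \<noteq> 0"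
      using lead2_mult[OF uv(2,3)] uv(1) by auto
    then have "const_poly (1 / lead2 y) * y \<in> fst ` labelled_products"
      using products_mem[OF monic_scale[OF uv(2)] monic_scale[OF uv(3)]] scale_mult[OF uv(2,3)] uv(1)
      by simp
    then have "F (const_poly (1 / lead2 y) * y) = 0"
      using F(2) by blast
    then have "G y = 0"
      unfolding G(2)[rule_format, OF ne(1)] by simp
    then show False using ne(2) by simp
  qed
qed

lemma SOS_fibre_components:
  assumes f: "f \<in> SOS n d 2" and c: "lead2 f \<noteq> 0"
    and good: "const_poly (1 / lead2 f) * f \<notin> fst ` labelled_bad"
  shows "card (irreducible_components (SOS_fibre_space n d 2 f)) = 2 \<and>
    (\<forall>Z\<in>irreducible_components (SOS_fibre_space n d 2 f).
      isomorphic_varieties (tuple_coeffs 2) Z matrix_entries SO2)"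
proof -
  obtain p q where pq: "unique_factors p q" "p \<noteq> q" "p * q = const_poly (1 / lead2 f) * f"
    using unique_factors_if_not_bad[OF _ _ good] SOS_monic_product[OF f c] by blast
  have p: "p \<in> monic_forms n d" and q: "q \<in> monic_forms n d"
    using pq(1) unfolding unique_factors_def by auto
  let ?P = "branch (lead2 f) p q ` (- {0})" and ?Q = "branch (lead2 f) q p ` (- {0})"
  let ?X = "zariski (tuple_coeffs 2) (SOS_fibre n d 2 f)"
  have X: "SOS_fibre n d 2 f = ?P \<union> ?Q"
    by (rule SOS_fibre_eq_branches[OF refl c pq(1,3)])
  have "SOS_fibre_space n d 2 f = ?X"
    unfolding SOS_fibre_space_def by (rule subtopology_zariski) (auto simp: SOS_fibre_def)
  moreover have "irreducible_components ?X = {?P, ?Q}"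
  proof (rule irreducible_components_disjoint_Un)
    show "topspace ?X = ?P \<union> ?Q" unfolding topspace_zariski by (rule X)
    show "?P \<inter> ?Q = {}" by (rule disjoint_branches[OF p q pq(2)])
    show "closedin ?X ?P" by (rule closedin_branch[OF p q pq(2) X])
    show "closedin ?X ?Q" by (rule closedin_branch[OF q p pq(2)[symmetric]]) (use X in blast)
    have "subtopology ?X ?P = zariski (tuple_coeffs 2) ?P" "subtopology ?X ?Q = zariski (tuple_coeffs 2) ?Q"
      unfolding X by (rule subtopology_zariski, blast)+
    then show "irreducible_space (subtopology ?X ?P)" "irreducible_space (subtopology ?X ?Q)"
      using irreducible_space_branch by simp_all
  qed
  moreover have "?P \<noteq> ?Q"
  proof -
    have "branch (lead2 f) p q 1 \<in> ?P" by (rule imageI) simp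
    then show ?thesis using disjoint_branches[OF p q pq(2), of "lead2 f"] by blast
  qed
  ultimately show ?thesis
    using isomorphic_branch_SO2[OF p q c] isomorphic_branch_SO2[OF q p c] by auto
qed

lemma generic_SOS_fibre:
  "generically (SOS_space n d 2) (\<lambda>f.
    card (irreducible_components (SOS_fibre_space n d 2 f)) = 2 \<and>
    (\<forall>Z\<in>irreducible_components (SOS_fibre_space n d 2 f).
      isomorphic_varieties (tuple_coeffs 2) Z matrix_entries SO2))"
proof -
  let ?I = "{u * v | u v. u \<in> Sym n d \<and> v \<in> Sym n d}"
  have SOS: "SOS n d 2 = zariski Defs.coeffs (Sym n (2 * d)) closure_of ?I"
    unfolding SOS_def sums_of_two_squares_eq_products ..
  have S0: "p0 \<in> Sym n d" "q0 \<in> Sym n d"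
    using p0_q0_monic by (auto simp: monic_forms_def)
  have lead0: "lead2 (p0 * q0) = 1"
    using lead2_mult[OF S0] p0_q0_monic by (simp add: monic_lead)
  have "closedin (zariski Defs.coeffs UNIV) (fst ` labelled_bad)"
    by (rule closedin_products[OF closedin_labelled_bad]) (simp add: labelled_bad_def)
  then obtain F where F: "F \<in> polynomial_functions Defs.coeffs"
      "\<forall>x\<in>fst ` labelled_bad. F x = 0" "F (p0 * q0) \<noteq> 0"
    using p0_q0_not_bad unfolding closedin_zariski by blast
  obtain k G where G: "G \<in> polynomial_functions Defs.coeffs"
      "\<forall>f. lead2 f \<noteq> 0 \<longrightarrow> G f = lead2 f ^ k * F (const_poly (1 / lead2 f) * f)"
    using polynomial_functions_rescale[OF F(1) polynomial_functions_lead2] by blast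
  have "\<forall>f\<in>?I. \<exists>x. f = fst x * snd x \<and> fst x \<in> Sym n d \<and> snd x \<in> Sym n d"
    by auto
  from bchoice[OF this] obtain fac
    where fac: "\<And>f. f \<in> ?I \<Longrightarrow> f = fst (fac f) * snd (fac f)"
      "\<And>f. f \<in> ?I \<Longrightarrow> fst (fac f) \<in> Sym n d" "\<And>f. f \<in> ?I \<Longrightarrow> snd (fac f) \<in> Sym n d"
    by blast
  \<comment> \<open>A segment in each factor separately, from \<open>p0\<close> and
    \<open>q0\<close> to the chosen factors of \<open>f\<close>: the curve stays among the products,
    and its coefficients are quadratic in \<open>t\<close>.\<close>
  define line where "line f t = (p0 + const_poly t * (fst (fac f) - p0)) *
    (q0 + const_poly t * (snd (fac f) - q0))" for f t
  show ?thesis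
    unfolding SOS_space_def SOS
  proof (rule generically_closure_ofI[where h = line])
    show "?I \<subseteq> Sym n (2 * d)"
      using Sym_mult[of _ n d _ d] by (auto simp: mult_2)
    show "p0 * q0 \<in> ?I" using S0 by blast
    \<comment> \<open>The factor \<open>lead2 f\<close> confines the open set to forms that can be
      normalized; \<open>G\<close> keeps their normalizations off the bad set.\<close>
    show "(\<lambda>f. lead2 f * G f) \<in> polynomial_functions Defs.coeffs"
      by (rule polynomial_functions.mult[OF polynomial_functions_lead2 G(1)])
    show "lead2 (p0 * q0) * G (p0 * q0) \<noteq> 0"
      using G(2) lead0 F(3) by simp
    fix f assume f: "f \<in> ?I"
    show "line f 0 = p0 * q0" by (simp add: line_def)
    show "line f 1 = f" using fac(1)[OF f] by (simp add: line_def)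
    show "line f t \<in> ?I" for t
    proof -
      have "p0 + const_poly t * (fst (fac f) - p0) \<in> Sym n d"
        "q0 + const_poly t * (snd (fac f) - q0) \<in> Sym n d"
        by (intro Sym_add Sym_scale Sym_diff S0 fac(2,3)[OF f])+
      then show ?thesis unfolding line_def by blast
    qed
    fix y assume "y \<in> Defs.coeffs"
    then obtain a where y: "y = (\<lambda>p. Poly_Mapping.lookup p a)" by (auto simp: Defs.coeffs_def)
    let ?U = "fst (fac f) - p0" and ?V = "snd (fac f) - q0"
    have "line f t = p0 * q0 + const_poly t * (p0 * ?V + ?U * q0) + const_poly t * (const_poly t * (?U * ?V))"
      for t
      unfolding line_def by (simp only: distrib_left distrib_right ac_simps)
    then show "\<exists>r. \<forall>t. y (line f t) = poly r t"
      by (intro exI[of _ "[:Poly_Mapping.lookup (p0 * q0) a, Poly_Mapping.lookup (p0 * ?V + ?U * q0) a,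
          Poly_Mapping.lookup (?U * ?V) a:]"])
        (simp only: y lookup_add[of _ _ a] lookup_single_0_mult poly_pCons poly_0, simp add: algebra_simps)
  next
    fix f
    assume "f \<in> zariski Defs.coeffs (Sym n (2 * d)) closure_of ?I" and H: "lead2 f * G f \<noteq> 0"
    then have f: "f \<in> SOS n d 2" unfolding SOS by blast
    have c: "lead2 f \<noteq> 0" using H by auto
    have "F (const_poly (1 / lead2 f) * f) \<noteq> 0"
      using H unfolding G(2)[rule_format, OF c] by auto
    then have "const_poly (1 / lead2 f) * f \<notin> fst ` labelled_bad"
      using F(2) by blast
    then show "card (irreducible_components (SOS_fibre_space n d 2 f)) = 2 \<and>
      (\<forall>Z\<in>irreducible_components (SOS_fibre_space n d 2 f).
        isomorphic_varieties (tuple_coeffs 2) Z matrix_entries SO2)"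
      by (rule SOS_fibre_components[OF f c])
  qed
qed

end

theorem theorem1p4:
  fixes n d :: nat
  assumes "n + 1 > 2" and "d \<ge> 1"
  shows "generically (SOS_space n d 2) (\<lambda>f.
    card (irreducible_components (SOS_fibre_space n d 2 f)) = 2 \<and>
    (\<forall>Z\<in>irreducible_components (SOS_fibre_space n d 2 f).
      isomorphic_varieties (tuple_coeffs 2) Z matrix_entries SO2))"
proof -
  interpret forms n d
    by unfold_locales (use assms in auto)
  show ?thesis by (rule generic_SOS_fibre)
qed

end
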